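(* Let $n\in\mathbb{N}$ and let $G$ be any loopless directed finite multigraph on the vertex set $[n+1]$ with edges directed $i\to j$ for $i<j$. Then for any $v\in\mathbb{Z}^{n+1}$ and $i,j\in[n+1]$, $$K_G(v)^2\ \geq\ K_G(v+\varepsilon_i-\varepsilon_j)\,K_G(v+\varepsilon_j-\varepsilon_i),$$ where $K_G$ denotes the restricted Kostant partition function of $G$. More strongly, if $\underline{\operatorname{ch}}_G(x)$ denotes the generating function of $K_G$, then $N(x^\delta\cdot\underline{\operatorname{ch}}_G(x))$ is Lorentzian for all $\delta\in\mathbb{N}^{n+1}$.
   Context: $\mathbb{N}$ denotes the nonnegative integers, $[m]=\{1,\dots,m\}$, $\varepsilon_1,\dots,\varepsilon_m$ is the coordinate basis of $\mathbb{Z}^m$, and $x^\mu=\prod_jx_j^{\mu_j}$. Restricted Kostant partition function: for $v\in\mathbb{Z}^{n+1}$, $K_G(v)$ is the number of ways to write $v$ as a sum of the vectors $\varepsilon_i-\varepsilon_j$ corresponding to edges $i\to j$ of $G$, with multiplicity; i.e. the number of functions $f:E(G)\to\mathbb{N}$ with $\sum_{e=(i\to j)\in E(G)}f(e)(\varepsilon_i-\varepsilon_j)=v$ (parallel edges are distinguished). Generating function: if $G$ has $m_{ij}\ge0$ edges $i\to j$ for $i<j$, then $$\underline{\operatorname{ch}}_G(x_1,\dots,x_{n+1})=\sum_{v\in\mathbb{Z}^{n+1}}K_G(v)x^{-v}=\prod_{i<j}\bigl(1+x_jx_i^{-1}+x_j^2x_i^{-2}+\cdots\bigr)^{m_{ij}},$$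 an element of $\mathbb{R}[[x_2/x_1,\dots,x_{n+1}/x_n]]$. Normalization operator: $N\bigl(\sum_{\mu\in\mathbb{Z}^m}c_\mu x^\mu\bigr)=\sum_{\mu\in\mathbb{N}^m}c_\mu \frac{x^\mu}{\mu!}$ with $\mu!=\prod_j\mu_j!$ (monomials with some negative exponent are discarded). Lorentzian: a homogeneous polynomial $h\in\mathbb{R}[x_1,\dots,x_m]$ of degree $d$ is Lorentzian if (i) its coefficients are nonnegative; (ii) its support $S\subset\mathbb{N}^m$ is M-convex, i.e. for $\alpha\neq\beta\in S$ and any $i$ with $\alpha_i>\beta_i$ there is $j$ with $\alpha_j<\beta_j$ and $\alpha-\varepsilon_i+\varepsilon_j\in S$; (iii) for any $i_1,\dots,i_{d-2}\in[m]$ the quadratic form $\partial_{x_{i_1}}\cdots\partial_{x_{i_{d-2}}}h$ has at most one positive eigenvalue (vacuous if $d<2$). The zero polynomial is Lorentzian. *)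

theory Defs
  imports
    "HOL-Library.Poly_Mapping"
    "Graph_Theory.Digraph"
    "Jordan_Normal_Form.Char_Poly"
begin

text \<open>
  Vectors of \<open>\<int>\<^sup>m\<close> (resp. \<open>\<nat>\<^sup>m\<close>) are elements of \<^typ>\<open>nat \<Rightarrow>\<^sub>0 int\<close> (resp.
  \<^typ>\<open>nat \<Rightarrow>\<^sub>0 nat\<close>) with keys in \<open>{1..m}\<close>, and the i-th basis vector is
  \<open>Poly_Mapping.single i 1\<close>.
\<close>

section \<open>The restricted Kostant partition function\<close>

definition increasing_multidigraph :: "nat \<Rightarrow> (nat, 'e) pre_digraph \<Rightarrow> bool" where
  "increasing_multidigraph m G \<longleftrightarrow>
     fin_digraph G \<and> loopfree_digraph G \<and> verts G = {1..m} \<and>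
     (\<forall>e\<in>arcs G. tail G e < head G e)"

text \<open>
  Functions on the arcs are extended by \<^const>\<open>undefined\<close> outside \<^term>\<open>arcs G\<close>, so that
  each of them is counted once.
\<close>

definition kostant_flows :: "(nat, 'e) pre_digraph \<Rightarrow> (nat \<Rightarrow>\<^sub>0 int) \<Rightarrow> ('e \<Rightarrow> nat) set" where
  "kostant_flows G v =
     {f \<in> arcs G \<rightarrow>\<^sub>E UNIV.
        (\<Sum>e\<in>arcs G. Poly_Mapping.single (tail G e) (int (f e))
                    - Poly_Mapping.single (head G e) (int (f e))) = v}"

definition kostant :: "(nat, 'e) pre_digraph \<Rightarrow> (nat \<Rightarrow>\<^sub>0 int) \<Rightarrow> nat" where
  "kostant G v = card (kostant_flows G v)"

text \<open>The cardinality above is that of a finite set: every arc strictly increases the vertex.\<close>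

lemma finite_kostant_flows:
  assumes "increasing_multidigraph m G"
  shows "finite (kostant_flows G v)"
proof -
  have fin: "finite (arcs G)"
    and tail: "\<And>e. e \<in> arcs G \<Longrightarrow> tail G e \<in> {1..m}"
    and head: "\<And>e. e \<in> arcs G \<Longrightarrow> head G e \<in> {1..m}"
    and less: "\<And>e. e \<in> arcs G \<Longrightarrow> tail G e < head G e"
    using assms fin_digraph.finite_arcs[of G] wf_digraph.tail_in_verts[of G]
      wf_digraph.head_in_verts[of G] loopfree_digraph.axioms(1)[of G]
    by (auto simp: increasing_multidigraph_def)
  define w :: "(nat \<Rightarrow>\<^sub>0 int) \<Rightarrow> int" where
    "w u = (\<Sum>i\<in>{1..m}. - int i * Poly_Mapping.lookup u i)" for u
  have w_sum: "w (\<Sum>e\<in>A. g e) = (\<Sum>e\<in>A. w (g e))" for A and g :: "'b \<Rightarrow> nat \<Rightarrow>\<^sub>0 int"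
    unfolding w_def lookup_sum sum_distrib_left by (rule sum.swap)
  have w_diff: "w (a - b) = w a - w b" for a b
    by (simp add: w_def lookup_minus right_diff_distrib sum_subtractf[symmetric] del: mult_minus_left)
  have w_single: "w (Poly_Mapping.single i c) = - int i * c" if "i \<in> {1..m}" for i c
    unfolding w_def using that
    by (subst sum.remove[of _ i]) (auto simp: lookup_single intro!: sum.neutral)
  have bound: "f e \<le> nat (w v)" if f: "f \<in> kostant_flows G v" and e: "e \<in> arcs G" for f e
  proof -
    have "w v = (\<Sum>e\<in>arcs G. (int (head G e) - int (tail G e)) * int (f e))"
      using f tail head
      by (auto simp: kostant_flows_def w_sum w_diff w_single algebra_simps intro!: sum.cong)
    moreover have "int (f e') \<le> (int (head G e') - int (tail G e')) * int (f e')"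
      if "e' \<in> arcs G" for e'
      using less[OF that] by (simp add: mult_le_cancel_right1)
    ultimately have "(\<Sum>e\<in>arcs G. int (f e)) \<le> w v"
      by (simp add: sum_mono)
    moreover have "int (f e) \<le> (\<Sum>e\<in>arcs G. int (f e))"
      using e fin by (intro member_le_sum) auto
    ultimately show ?thesis by linarith
  qed
  have "kostant_flows G v \<subseteq> arcs G \<rightarrow>\<^sub>E {..nat (w v)}"
  proof
    fix f assume f: "f \<in> kostant_flows G v"
    then have "f \<in> extensional (arcs G)"
      by (simp add: kostant_flows_def PiE_iff)
    then show "f \<in> arcs G \<rightarrow>\<^sub>E {..nat (w v)}"
      using bound[OF f] by (simp add: PiE_iff)
  qed
  then show ?thesis
    using finite_PiE[OF fin, of "\<lambda>_. {..nat (w v)}"] finite_subset by blast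
qed

section \<open>Formal Laurent series\<close>

text \<open>
  A formal Laurent series is represented by its coefficients; \<open>c \<mu>\<close> is the coefficient of
  the monomial with exponent vector \<open>\<mu>\<close>.
\<close>

type_synonym laurent = "(nat \<Rightarrow>\<^sub>0 int) \<Rightarrow> real"

definition kostant_gf :: "(nat, 'e) pre_digraph \<Rightarrow> laurent" where
  "kostant_gf G = (\<lambda>\<mu>. real (kostant G (- \<mu>)))"

abbreviation int_exponent :: "(nat \<Rightarrow>\<^sub>0 nat) \<Rightarrow> (nat \<Rightarrow>\<^sub>0 int)" where
  "int_exponent \<equiv> Poly_Mapping.map int"

definition monom_times :: "(nat \<Rightarrow>\<^sub>0 nat) \<Rightarrow> laurent \<Rightarrow> laurent" where
  "monom_times \<delta> c = (\<lambda>\<mu>. c (\<mu> - int_exponent \<delta>))"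

definition normalize_series :: "laurent \<Rightarrow> (nat \<Rightarrow>\<^sub>0 nat) \<Rightarrow> real" where
  "normalize_series c =
     (\<lambda>\<mu>. c (int_exponent \<mu>) / (\<Prod>j\<in>Poly_Mapping.keys \<mu>. fact (Poly_Mapping.lookup \<mu> j)))"

section \<open>Lorentzian polynomials\<close>

type_synonym mpolynomial = "(nat \<Rightarrow>\<^sub>0 nat) \<Rightarrow>\<^sub>0 real"

definition homogeneous_poly :: "nat \<Rightarrow> nat \<Rightarrow> mpolynomial \<Rightarrow> bool" where
  "homogeneous_poly m d h \<longleftrightarrow>
     (\<forall>\<alpha>\<in>Poly_Mapping.keys h. Poly_Mapping.keys \<alpha> \<subseteq> {1..m} \<and>
        (\<Sum>i\<in>{1..m}. Poly_Mapping.lookup \<alpha> i) = d)"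

text \<open>
  The subtraction of exponents is truncated only in terms whose coefficient vanishes.
\<close>

definition partial_deriv :: "nat \<Rightarrow> mpolynomial \<Rightarrow> mpolynomial" where
  "partial_deriv i h =
     (\<Sum>\<alpha>\<in>Poly_Mapping.keys h.
        Poly_Mapping.single (\<alpha> - Poly_Mapping.single i 1)
          (real (Poly_Mapping.lookup \<alpha> i) * Poly_Mapping.lookup h \<alpha>))"

definition M_convex :: "nat \<Rightarrow> (nat \<Rightarrow>\<^sub>0 nat) set \<Rightarrow> bool" where
  "M_convex m S \<longleftrightarrow>
     (\<forall>\<alpha>\<in>S. \<forall>\<beta>\<in>S. \<alpha> \<noteq> \<beta> \<longrightarrow>
       (\<forall>i\<in>{1..m}. Poly_Mapping.lookup \<alpha> i > Poly_Mapping.lookup \<beta> i \<longrightarrow>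
         (\<exists>j\<in>{1..m}. Poly_Mapping.lookup \<alpha> j < Poly_Mapping.lookup \<beta> j \<and>
            \<alpha> - Poly_Mapping.single i 1 + Poly_Mapping.single j 1 \<in> S)))"

text \<open>
  The symmetric matrix of a quadratic form in the variables \<open>1, \<dots>, m\<close>; rows and columns of
  matrices are indexed from 0.
\<close>

definition quadratic_form_mat :: "nat \<Rightarrow> mpolynomial \<Rightarrow> real mat" where
  "quadratic_form_mat m q = mat m m (\<lambda>(r, s).
     if r = s then Poly_Mapping.lookup q (Poly_Mapping.single (Suc r) 2)
     else Poly_Mapping.lookup q
            (Poly_Mapping.single (Suc r) 1 + Poly_Mapping.single (Suc s) 1) / 2)"

text \<open>Eigenvalues are counted with multiplicity.\<close>

definition num_pos_eigenvalues :: "real mat \<Rightarrow> nat" where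
  "num_pos_eigenvalues A =
     (\<Sum>a | eigenvalue A a \<and> a > 0. Polynomial.order a (char_poly A))"

definition lorentzian :: "nat \<Rightarrow> mpolynomial \<Rightarrow> bool" where
  "lorentzian m h \<longleftrightarrow>
     (\<exists>d. homogeneous_poly m d h \<and>
        (\<forall>\<alpha>. Poly_Mapping.lookup h \<alpha> \<ge> 0) \<and>
        M_convex m (Poly_Mapping.keys h) \<and>
        (d \<ge> 2 \<longrightarrow>
          (\<forall>is. length is = d - 2 \<and> set is \<subseteq> {1..m} \<longrightarrow>
             num_pos_eigenvalues (quadratic_form_mat m (foldr partial_deriv is h)) \<le> 1)))"

end

theory Submission
  imports Defs "Jordan_Normal_Form.Schur_Decomposition"
begin

text \<open>
  The coefficients of the quadratic forms in the definition of a Lorentzian polynomial are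
  \<open>K\<^sub>G(w - \<epsilon>\<^sub>i - \<epsilon>\<^sub>j) / 2\<close>, so both claims follow once these matrices have at most one positive
  eigenvalue for every \<open>w\<close>. Up to adding arcs from an extra root 0, they are mixed volumes of flow
  polytopes, and the argument follows the Hodge-Riemann style proof of the Alexandrov-Fenchel
  inequality. Let \<open>D\<^sub>x\<close> be the operator \<open>c \<mapsto> (w \<mapsto> \<Sum>\<^sub>i x\<^sub>i c(w - \<epsilon>\<^sub>i))\<close>. For an arc \<open>e = (i, j)\<close> one has
  \<open>D\<^sub>u K\<^sub>G(w) = K\<^sub>H(w - \<epsilon>\<^sub>j)\<close> where \<open>u = \<epsilon>\<^sub>j - \<epsilon>\<^sub>i\<close> and \<open>H\<close> arises from \<open>G\<close> by deleting \<open>e\<close>. A positive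
  vector \<open>a\<close> is a positive combination of these directions, so the form \<open>B(x, y) = D\<^sub>a D\<^sub>x D\<^sub>y \<dots> K\<^sub>G\<close> is a
  positive combination of forms of smaller graphs. Their hyperbolicity gives a
  Bochner-type inequality for \<open>B\<close>; together with a Perron-Frobenius argument on the set of arcs it
  shows that \<open>B\<close> is hyperbolic. M-convexity of the support is an exchange along residual paths.
\<close>

section \<open>Hyperbolic forms and the spectral gap\<close>

text \<open>Two obstacles shape the construction. A direction
  \<open>\<epsilon>\<^sub>j - \<epsilon>\<^sub>i\<close> has a negative entry, so positivity returns
  only once it has been absorbed by deleting its arc; the induction therefore runs over all arc sets
  at once. And directions between inner vertices have coordinate sum 0, so they cannot combine to a
  positive vector; an arc out of the root supplies a bare \<open>\<epsilon>\<^sub>j\<close>. The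
  passage from the Bochner inequality to hyperbolicity is spectral. Scale the direction of each arc
  e by its coefficient in \<open>a\<close>, and let C be the Gram matrix of B on these vectors, with
  row sums p. The operator C/p is self-adjoint for the weights p and fixes constants. The inequality
  says that it is bounded by its square, so each eigenvalue satisfies
  \<open>\<lambda> \<le> \<lambda>\<^sup>2\<close>. Nonnegative off-diagonal entries make 1 the
  largest eigenvalue and connectivity makes it simple, so all others are at most 0. Constants
  represent \<open>a\<close>, hence B is nonpositive on the complement of \<open>a\<close>. The
  diagonal of C may be negative, so C need not be a genuine Markov chain.\<close>

lemma exists_orthogonal_residual:
  fixes c :: "'j \<Rightarrow> 'i \<Rightarrow> real"
  assumes "finite J" and I: "finite I"
  shows "\<exists>y. \<forall>j\<in>J. (\<Sum>i\<in>I. (b i - (\<Sum>k\<in>J. y k * c k i)) * c j i) = 0"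
  using assms(1)
proof (induction J arbitrary: b rule: finite_induct)
  case empty
  then show ?case by simp
next
  case (insert k J)
  obtain y where y: "\<And>j. j \<in> J \<Longrightarrow> (\<Sum>i\<in>I. (b i - (\<Sum>l\<in>J. y l * c l i)) * c j i) = 0"
    using insert.IH[of b] by blast
  obtain y' where y': "\<And>j. j \<in> J \<Longrightarrow> (\<Sum>i\<in>I. (c k i - (\<Sum>l\<in>J. y' l * c l i)) * c j i) = 0"
    using insert.IH[of "c k"] by blast
  define r where "r i = b i - (\<Sum>l\<in>J. y l * c l i)" for i
  define r' where "r' i = c k i - (\<Sum>l\<in>J. y' l * c l i)" for i
  \<comment> \<open>Gram-Schmidt: \<open>r'\<close> is the part of \<open>c k\<close> orthogonal to
    the earlier vectors, so only the projection of \<open>r\<close> on \<open>r'\<close> has to be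
    removed. If \<open>r'\<close> vanishes on I, division by zero gives \<open>s = 0\<close>, and
    \<open>r\<close> is already orthogonal to \<open>c k\<close>.\<close>
  define s where "s = (\<Sum>i\<in>I. r i * r' i) / (\<Sum>i\<in>I. r' i * r' i)"
  define Y where "Y j = (if j = k then s else y j - s * y' j)" for j
  have Y: "b i - (\<Sum>l\<in>insert k J. Y l * c l i) = r i - s * r' i" for i
  proof -
    have "(\<Sum>l\<in>J. Y l * c l i) = (\<Sum>l\<in>J. y l * c l i) - s * (\<Sum>l\<in>J. y' l * c l i)"
      unfolding sum_distrib_left sum_subtractf[symmetric]
      by (rule sum.cong) (use insert.hyps in \<open>auto simp: Y_def algebra_simps\<close>)
    then show ?thesis
      using insert.hyps by (simp add: r_def r'_def Y_def algebra_simps)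
  qed
  have ort: "(\<Sum>i\<in>I. r i * c j i) = 0" "(\<Sum>i\<in>I. r' i * c j i) = 0" if "j \<in> J" for j
    using y[OF that] y'[OF that] by (simp_all add: r_def r'_def)
  have ck: "(\<Sum>i\<in>I. f i * c k i) = (\<Sum>i\<in>I. f i * r' i)"
    if "\<And>j. j \<in> J \<Longrightarrow> (\<Sum>i\<in>I. f i * c j i) = 0" for f
  proof -
    have "(\<Sum>i\<in>I. f i * (\<Sum>l\<in>J. y' l * c l i)) = (\<Sum>l\<in>J. y' l * (\<Sum>i\<in>I. f i * c l i))"
      unfolding sum_distrib_left by (subst sum.swap) (simp add: mult_ac)
    also have "\<dots> = 0"
      using that by simp
    finally show ?thesis
      by (simp add: r'_def right_diff_distrib sum_subtractf)
  qed
  have s: "(\<Sum>i\<in>I. r i * r' i) = s * (\<Sum>i\<in>I. r' i * r' i)"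
  proof (cases "(\<Sum>i\<in>I. r' i * r' i) = 0")
    case True
    then have "\<forall>i\<in>I. r' i = 0"
      using sum_nonneg_eq_0_iff[OF I, of "\<lambda>i. r' i * r' i"] by simp
    then show ?thesis by simp
  qed (simp add: s_def)
  have "(\<Sum>i\<in>I. (r i - s * r' i) * c j i) = 0" if "j \<in> insert k J" for j
  proof -
    have "(\<Sum>i\<in>I. (r i - s * r' i) * c j i)
        = (\<Sum>i\<in>I. r i * c j i) - s * (\<Sum>i\<in>I. r' i * c j i)"
      by (simp add: algebra_simps sum_subtractf sum_distrib_left)
    then show ?thesis
      using that ort ck[of r] ck[of r'] s by auto
  qed
  then show ?case
    unfolding Y[symmetric] by blast
qed

text \<open>With the Laplacian \<open>L\<close> and its energy form \<open>E\<close>, solve \<open>L y = p z\<close>. The square condition for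
  \<open>y\<close> bounds \<open>E y y\<close> by \<open>P = \<Sum>\<^sub>i p\<^sub>i z\<^sub>i\<^sup>2 = E z y\<close>, and \<open>E (y - z) (y - z) \<ge> 0\<close> then yields \<open>P \<le> E z z\<close>.\<close>

lemma reversible_chain_spectral_gap:
  fixes C :: "'i \<Rightarrow> 'i \<Rightarrow> real"
  assumes fin: "finite I"
    and sym: "\<And>i j. i \<in> I \<Longrightarrow> j \<in> I \<Longrightarrow> C i j = C j i"
    and nonneg: "\<And>i j. i \<in> I \<Longrightarrow> j \<in> I \<Longrightarrow> i \<noteq> j \<Longrightarrow> C i j \<ge> 0"
    and row: "\<And>i. i \<in> I \<Longrightarrow> (\<Sum>j\<in>I. C i j) = p i"
    and pos: "\<And>i. i \<in> I \<Longrightarrow> p i > 0"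
    and conn: "\<And>i j. i \<in> I \<Longrightarrow> j \<in> I \<Longrightarrow> i \<noteq> j \<Longrightarrow>
      C i j > 0 \<or> (\<exists>k\<in>I. k \<noteq> i \<and> k \<noteq> j \<and> C i k > 0 \<and> C k j > 0)"
    and square: "\<And>f. (\<Sum>i\<in>I. \<Sum>j\<in>I. C i j * f i * f j) \<le> (\<Sum>i\<in>I. (\<Sum>j\<in>I. C i j * f j)\<^sup>2 / p i)"
    and orth: "(\<Sum>i\<in>I. p i * z i) = 0"
  shows "(\<Sum>i\<in>I. \<Sum>j\<in>I. C i j * z i * z j) \<le> 0"
proof -
  define L where "L f i = p i * f i - (\<Sum>j\<in>I. C i j * f j)" for f i
  define E where "E f g = (\<Sum>i\<in>I. f i * L g i)" for f g
  have E_alt: "E f g = (\<Sum>i\<in>I. p i * f i * g i) - (\<Sum>i\<in>I. \<Sum>j\<in>I. C i j * f i * g j)" for f g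
    by (simp add: E_def L_def right_diff_distrib sum_subtractf sum_distrib_left mult_ac)
  have C_swap: "(\<Sum>i\<in>I. \<Sum>j\<in>I. C i j * f i * g j) = (\<Sum>i\<in>I. \<Sum>j\<in>I. C i j * g i * f j)" for f g
    by (subst sum.swap, intro sum.cong refl) (simp add: sym mult_ac)
  have E_sym: "E f g = E g f" for f g
    using C_swap[of f g] by (simp add: E_alt mult_ac)
  have E_dirichlet: "2 * E f f = (\<Sum>i\<in>I. \<Sum>j\<in>I. C i j * (f i - f j)\<^sup>2)" for f
  proof -
    have d: "(\<Sum>i\<in>I. p i * f i * f i) = (\<Sum>i\<in>I. \<Sum>j\<in>I. C i j * f i * f i)"
      by (intro sum.cong refl) (simp add: row[symmetric] sum_distrib_left sum_distrib_right mult_ac)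
    have "(\<Sum>i\<in>I. \<Sum>j\<in>I. C i j * f i * f i) = (\<Sum>i\<in>I. \<Sum>j\<in>I. C i j * f j * f j)"
      by (subst sum.swap, intro sum.cong refl) (simp add: sym)
    moreover have "(\<Sum>i\<in>I. \<Sum>j\<in>I. C i j * (f i - f j)\<^sup>2)
      = (\<Sum>i\<in>I. \<Sum>j\<in>I. C i j * f i * f i) + (\<Sum>i\<in>I. \<Sum>j\<in>I. C i j * f j * f j)
        - 2 * (\<Sum>i\<in>I. \<Sum>j\<in>I. C i j * f i * f j)"
      unfolding sum_distrib_left sum.distrib[symmetric] sum_subtractf[symmetric]
      by (intro sum.cong refl) (simp add: power2_eq_square algebra_simps)
    ultimately show ?thesis
      by (simp add: E_alt d)
  qed
  \<comment> \<open>The diagonal entries of C may have any sign, but they only meet the square of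
    \<open>f i - f i\<close>.\<close>
  have term_nonneg: "C i j * (f i - f j)\<^sup>2 \<ge> 0" if "i \<in> I" "j \<in> I" for f i j
    using nonneg[OF that] by (cases "i = j") auto
  have E_nonneg: "E f f \<ge> 0" for f
  proof -
    have "(\<Sum>i\<in>I. \<Sum>j\<in>I. C i j * (f i - f j)\<^sup>2) \<ge> 0"
      by (intro sum_nonneg term_nonneg)
    then show ?thesis using E_dirichlet[of f] by simp
  qed
  have kernel: "f i = f j" if "E f f = 0" "i \<in> I" "j \<in> I" for f i j
  proof -
    have edge: "C i j * (f i - f j)\<^sup>2 = 0" if "i \<in> I" "j \<in> I" for i j
    proof -
      have "(\<Sum>i\<in>I. \<Sum>j\<in>I. C i j * (f i - f j)\<^sup>2) = 0"
        using E_dirichlet[of f] \<open>E f f = 0\<close> by simp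
      then have "(\<Sum>j\<in>I. C i j * (f i - f j)\<^sup>2) = 0"
        using sum_nonneg_eq_0_iff[OF fin, of "\<lambda>i. \<Sum>j\<in>I. C i j * (f i - f j)\<^sup>2"] that
          term_nonneg by (simp add: sum_nonneg)
      then show ?thesis
        using sum_nonneg_eq_0_iff[OF fin, of "\<lambda>j. C i j * (f i - f j)\<^sup>2"] that term_nonneg
        by simp
    qed
    show ?thesis
    proof (cases "i = j")
      case False
      from conn[OF that(2,3) this] show ?thesis
      proof
        assume "C i j > 0"
        then show ?thesis using edge[OF that(2,3)] by simp
      next
        assume "\<exists>k\<in>I. k \<noteq> i \<and> k \<noteq> j \<and> C i k > 0 \<and> C k j > 0"
        then obtain k where "k \<in> I" "C i k > 0" "C k j > 0" by blast
        then show ?thesis using edge[OF that(2), of k] edge[OF _ that(3), of k] by simp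
      qed
    qed simp
  qed
  \<comment> \<open>A Fredholm alternative: the least-squares residual r of \<open>L y = p z\<close>
    satisfies \<open>E r r = 0\<close>, hence is constant by connectivity. Its sum is zero because
    both \<open>p z\<close> and \<open>L y\<close> sum to zero, so r vanishes.\<close>
  obtain y where y: "\<And>i. i \<in> I \<Longrightarrow> L y i = p i * z i"
  proof -
    define c where "c k i = L (\<lambda>l. if l = k then 1 else 0) i" for k i
    have Lc: "L f i = (\<Sum>k\<in>I. f k * c k i)" if "i \<in> I" for f i
    proof -
      have "c k i = (if i = k then p i else 0) - C i k" if "k \<in> I" for k
        using that fin by (auto simp: c_def L_def if_distrib[of "\<lambda>x. _ * x"] cong: if_cong)
      then have "(\<Sum>k\<in>I. f k * c k i) = (\<Sum>k\<in>I. f k * (if i = k then p i else 0)) - (\<Sum>k\<in>I. f k * C i k)"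
        by (simp add: right_diff_distrib sum_subtractf)
      moreover have "(\<Sum>k\<in>I. f k * (if i = k then p i else 0)) = f i * p i"
        using that fin by (simp add: if_distrib[of "\<lambda>x. _ * x"] cong: if_cong)
      ultimately show ?thesis by (simp add: L_def mult_ac)
    qed
    obtain y where y: "\<And>j. j \<in> I \<Longrightarrow> (\<Sum>i\<in>I. (p i * z i - (\<Sum>k\<in>I. y k * c k i)) * c j i) = 0"
      using exists_orthogonal_residual[OF fin fin, of "\<lambda>i. p i * z i" c] by blast
    define r where "r i = p i * z i - L y i" for i
    have "(\<Sum>i\<in>I. r i * c j i) = 0" if "j \<in> I" for j
      using y[OF that] by (simp add: r_def Lc)
    then have "(\<Sum>j\<in>I. r j * (\<Sum>i\<in>I. r i * c j i)) = 0" by simp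
    moreover have "E r r = (\<Sum>j\<in>I. r j * (\<Sum>i\<in>I. r i * c j i))"
    proof -
      have "E r r = (\<Sum>i\<in>I. \<Sum>j\<in>I. r j * (r i * c j i))"
        unfolding E_def by (intro sum.cong refl) (simp add: Lc sum_distrib_left mult_ac)
      then show ?thesis
        by (subst (asm) sum.swap) (simp add: sum_distrib_left)
    qed
    ultimately have Er: "E r r = 0" by simp
    have Lsum: "(\<Sum>i\<in>I. L y i) = 0"
    proof -
      have "(\<Sum>i\<in>I. L y i) = E (\<lambda>_. 1) y" by (simp add: E_def)
      also have "\<dots> = E y (\<lambda>_. 1)" by (rule E_sym)
      also have "\<dots> = 0" by (simp add: E_def L_def row)
      finally show ?thesis .
    qed
    have "(\<Sum>i\<in>I. r i * r i) = 0"
    proof (cases "I = {}")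
      case False
      then obtain k where k: "k \<in> I" by blast
      have "(\<Sum>i\<in>I. r i * r i) = (\<Sum>i\<in>I. r k * r i)"
        using kernel[OF Er k] by (intro sum.cong) simp_all
      also have "\<dots> = r k * ((\<Sum>i\<in>I. p i * z i) - (\<Sum>i\<in>I. L y i))"
        by (simp add: sum_distrib_left[symmetric] r_def sum_subtractf)
      finally show ?thesis by (simp add: orth Lsum)
    qed simp
    then have "\<forall>i\<in>I. r i = 0"
      using sum_nonneg_eq_0_iff[OF fin, of "\<lambda>i. r i * r i"] by simp
    then show thesis using that[of y] by (simp add: r_def)
  qed
  define P where "P = (\<Sum>i\<in>I. p i * z i * z i)"
  have Eyz: "E z y = P"
    by (simp add: E_def P_def y mult_ac)
  have Eyy: "E y y = (\<Sum>i\<in>I. p i * y i * z i)"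
    by (simp add: E_def y mult_ac)
  have "E y y \<le> P"
  proof -
    have S: "(\<Sum>j\<in>I. C i j * y j) = p i * (y i - z i)" if "i \<in> I" for i
      using y[OF that] by (simp add: L_def algebra_simps)
    have "(\<Sum>i\<in>I. \<Sum>j\<in>I. C i j * y i * y j) = (\<Sum>i\<in>I. y i * (p i * (y i - z i)))"
      by (intro sum.cong refl) (simp add: S[symmetric] sum_distrib_left mult_ac)
    moreover have "(\<Sum>i\<in>I. (\<Sum>j\<in>I. C i j * y j)\<^sup>2 / p i) = (\<Sum>i\<in>I. p i * (y i - z i)\<^sup>2)"
      using pos by (intro sum.cong refl) (simp add: S power2_eq_square less_imp_neq[symmetric])
    ultimately have "0 \<le> (\<Sum>i\<in>I. p i * (y i - z i)\<^sup>2) - (\<Sum>i\<in>I. y i * (p i * (y i - z i)))"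
      using square[of y] by simp
    also have "\<dots> = P - (\<Sum>i\<in>I. p i * y i * z i)"
      unfolding P_def sum_subtractf[symmetric]
      by (intro sum.cong refl) (simp add: power2_eq_square algebra_simps)
    finally show ?thesis by (simp add: Eyy)
  qed
  moreover have "E (\<lambda>i. y i - z i) (\<lambda>i. y i - z i) = E y y - 2 * P + E z z"
  proof -
    have "E (\<lambda>i. y i - z i) (\<lambda>i. y i - z i) = E y y - E y z - E z y + E z z"
      by (simp add: E_alt algebra_simps sum_subtractf sum.distrib sum_distrib_left sum_distrib_right)
    then show ?thesis using Eyz E_sym[of y z] by simp
  qed
  ultimately have "P \<le> E z z"
    using E_nonneg[of "\<lambda>i. y i - z i"] by simp
  then show ?thesis
    by (simp add: E_alt P_def)
qed

section \<open>Reversed Cauchy-Schwarz inequalities for bilinear forms\<close>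

text \<open>For a symmetric bilinear form this excludes a positive definite plane, that is, a second
  positive eigenvalue. The argument type carries no vector space structure: linear combinations are
  asked for only through their pairing with every \<open>u\<close>, hence modulo the
  radical.\<close>

definition hyperbolic :: "('v \<Rightarrow> 'v \<Rightarrow> real) \<Rightarrow> bool" where
  "hyperbolic B \<longleftrightarrow> (\<forall>x y. B y y > 0 \<longrightarrow> B x x * B y y \<le> (B x y)\<^sup>2)"

text \<open>The combination of x and y with coefficients \<open>B y a\<close> and
  \<open>- B x a\<close> is orthogonal to \<open>a\<close>. Multiplying its inequality by
  \<open>B y y\<close> and completing a square leaves the claim times the square of
  \<open>B y a\<close>, which is nonzero because \<open>B y y > 0\<close> keeps y from being
  orthogonal to \<open>a\<close>.\<close>

lemma hyperbolic_if_orthogonal_nonpos: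
  assumes sym: "\<And>x y. B x y = B y x"
    and lin: "\<And>\<alpha> \<beta> x y. \<exists>z. \<forall>u. B z u = \<alpha> * B x u - \<beta> * B y u"
    and neg: "\<And>x. B x a = 0 \<Longrightarrow> B x x \<le> 0"
  shows "hyperbolic B"
  unfolding hyperbolic_def
proof (intro allI impI)
  fix x y assume pos: "B y y > 0"
  obtain z where z: "\<And>u. B z u = B y a * B x u - B x a * B y u"
    using lin by blast
  have "B z z \<le> 0" by (rule neg) (simp add: z)
  moreover have "B z z = (B y a)\<^sup>2 * B x x - 2 * B y a * B x a * B x y + (B x a)\<^sup>2 * B y y"
    by (simp add: z sym[of x z] sym[of y z] sym[of y x] power2_eq_square algebra_simps)
  ultimately have "((B y a)\<^sup>2 * B x x - 2 * B y a * B x a * B x y + (B x a)\<^sup>2 * B y y) * B y y \<le> 0"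
    using pos by (simp add: mult_nonpos_nonneg)
  then have "(B y a)\<^sup>2 * (B x x * B y y - (B x y)\<^sup>2) + (B y a * B x y - B x a * B y y)\<^sup>2 \<le> 0"
    by (simp add: power2_eq_square algebra_simps)
  then have "(B y a)\<^sup>2 * (B x x * B y y - (B x y)\<^sup>2) \<le> 0"
    by (smt (verit) zero_le_power2)
  moreover have "B y a \<noteq> 0" using neg[of y] pos by auto
  ultimately show "B x x * B y y \<le> (B x y)\<^sup>2"
    by (simp add: mult_le_0_iff not_less_iff_gr_or_eq)
qed

text \<open>Coordinates are taken with respect to the vectors \<open>d e\<close> scaled by
  \<open>t e\<close>. Then \<open>a\<close> becomes the constant function 1, the Gram matrix
  \<open>C\<close> has row sums \<open>p\<close>, and \<open>B x a = 0\<close> turns into the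
  orthogonality required by the spectral gap.\<close>

lemma hyperbolic_if_frame:
  fixes B :: "'v \<Rightarrow> 'v \<Rightarrow> real" and d :: "'o \<Rightarrow> 'v"
  assumes fin: "finite I"
    and sym: "\<And>x y. B x y = B y x"
    and lin: "\<And>\<alpha> \<beta> x y. \<exists>z. \<forall>u. B z u = \<alpha> * B x u - \<beta> * B y u"
    and comb: "\<And>s. \<exists>x. \<forall>u. B x u = (\<Sum>e\<in>I. s e * B (d e) u)"
    and span: "\<And>x. \<exists>s. \<forall>u. B x u = (\<Sum>e\<in>I. s e * B (d e) u)"
    and t: "\<And>e. e \<in> I \<Longrightarrow> t e > 0"
    and a: "\<And>u. B a u = (\<Sum>e\<in>I. t e * B (d e) u)"
    and pos: "\<And>e. e \<in> I \<Longrightarrow> B (d e) a > 0"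
    and nonneg: "\<And>e e'. e \<in> I \<Longrightarrow> e' \<in> I \<Longrightarrow> e \<noteq> e' \<Longrightarrow> B (d e) (d e') \<ge> 0"
    and conn: "\<And>e e'. e \<in> I \<Longrightarrow> e' \<in> I \<Longrightarrow> e \<noteq> e' \<Longrightarrow>
      B (d e) (d e') > 0 \<or> (\<exists>k\<in>I. k \<noteq> e \<and> k \<noteq> e' \<and> B (d e) (d k) > 0 \<and> B (d k) (d e') > 0)"
    and square: "\<And>x. B x x \<le> (\<Sum>e\<in>I. t e * (B (d e) x)\<^sup>2 / B (d e) a)"
  shows "hyperbolic B"
proof (rule hyperbolic_if_orthogonal_nonpos[OF sym lin])
  fix x assume xa: "B x a = 0"
  obtain s where s: "\<And>u. B x u = (\<Sum>e\<in>I. s e * B (d e) u)"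
    using span by blast
  define C where "C e e' = t e * t e' * B (d e) (d e')" for e e'
  define p where "p e = t e * B (d e) a" for e
  have combined: "(\<Sum>e\<in>I. \<Sum>e'\<in>I. C e e' * f e * f e') = B y y"
    "e \<in> I \<Longrightarrow> (\<Sum>e'\<in>I. C e e' * f e') = t e * B (d e) y"
    if y: "\<And>u. B y u = (\<Sum>e\<in>I. f e * t e * B (d e) u)" for f y e
  proof -
    show *: "(\<Sum>e'\<in>I. C e e' * f e') = t e * B (d e) y" for e
      unfolding sym[of _ y] y sum_distrib_left
      by (intro sum.cong refl) (simp add: C_def sym[of "d e"] mult_ac)
    have "(\<Sum>e\<in>I. \<Sum>e'\<in>I. C e e' * f e * f e') = (\<Sum>e\<in>I. f e * (t e * B (d e) y))"
      unfolding *[symmetric] sum_distrib_left by (simp add: mult_ac)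
    then show "(\<Sum>e\<in>I. \<Sum>e'\<in>I. C e e' * f e * f e') = B y y"
      by (subst y) (simp add: mult_ac)
  qed
  have x: "B x u = (\<Sum>e\<in>I. (s e / t e) * t e * B (d e) u)" for u
    unfolding s using t by (intro sum.cong refl) (simp add: less_imp_neq[symmetric])
  have "(\<Sum>e\<in>I. \<Sum>e'\<in>I. C e e' * (s e / t e) * (s e' / t e')) \<le> 0"
  proof (rule reversible_chain_spectral_gap[where p = p])
    show "C e e' = C e' e" for e e'
      by (simp add: C_def sym mult_ac)
    show "0 \<le> C e e'" if "e \<in> I" "e' \<in> I" "e \<noteq> e'" for e e'
      using nonneg[OF that] t that by (simp add: C_def less_imp_le)
    show "(\<Sum>e'\<in>I. C e e') = p e" if "e \<in> I" for e
      using combined(2)[of a "\<lambda>_. 1", OF _ that] a by (simp add: p_def)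
    show "0 < p e" if "e \<in> I" for e
      using t pos that by (simp add: p_def)
    show "0 < C e e' \<or> (\<exists>k\<in>I. k \<noteq> e \<and> k \<noteq> e' \<and> 0 < C e k \<and> 0 < C k e')"
      if "e \<in> I" "e' \<in> I" "e \<noteq> e'" for e e'
      using conn[OF that] t that unfolding C_def by (meson mult_pos_pos)
    show "(\<Sum>e\<in>I. \<Sum>e'\<in>I. C e e' * f e * f e') \<le> (\<Sum>e\<in>I. (\<Sum>e'\<in>I. C e e' * f e')\<^sup>2 / p e)" for f
    proof -
      obtain y where y: "\<And>u. B y u = (\<Sum>e\<in>I. f e * t e * B (d e) u)"
        using comb[of "\<lambda>e. f e * t e"] by blast
      have "(\<Sum>e\<in>I. (\<Sum>e'\<in>I. C e e' * f e')\<^sup>2 / p e) = (\<Sum>e\<in>I. t e * (B (d e) y)\<^sup>2 / B (d e) a)"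
      proof (intro sum.cong refl)
        fix e assume e: "e \<in> I"
        show "(\<Sum>e'\<in>I. C e e' * f e')\<^sup>2 / p e = t e * (B (d e) y)\<^sup>2 / B (d e) a"
          unfolding combined(2)[OF y e] p_def using t[OF e] by (simp add: power2_eq_square)
      qed
      then show ?thesis
        using square[of y] by (simp add: combined(1)[OF y])
    qed
    show "(\<Sum>e\<in>I. p e * (s e / t e)) = 0"
    proof -
      have "(\<Sum>e\<in>I. p e * (s e / t e)) = (\<Sum>e\<in>I. s e * B (d e) a)"
        using t by (intro sum.cong refl) (simp add: p_def less_imp_neq[symmetric])
      then show ?thesis using s[of a] xa by simp
    qed
  qed fact
  then show "B x x \<le> 0"
    using combined(1)[OF x] by simp
qed

text \<open>The Gram determinant of x and y is that of e and f times the square of their coordinate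
  determinant.\<close>

lemma hyperbolic_if_rank_two:
  fixes B :: "'v \<Rightarrow> 'v \<Rightarrow> real"
  assumes sym: "\<And>x y. B x y = B y x"
    and B: "\<And>x. \<exists>X Y. \<forall>u. B x u = X * B e u + Y * B f u"
    and det: "B e e * B f f \<le> (B e f)\<^sup>2"
  shows "hyperbolic B"
  unfolding hyperbolic_def
proof (intro allI impI)
  fix x y
  obtain X X' where x: "\<And>u. B x u = X * B e u + X' * B f u" using B by blast
  obtain Y Y' where y: "\<And>u. B y u = Y * B e u + Y' * B f u" using B by blast
  have "B x x * B y y - (B x y)\<^sup>2 = (B e e * B f f - (B e f)\<^sup>2) * (X * Y' - X' * Y)\<^sup>2"
    by (simp add: x y sym[of e x] sym[of f x] sym[of e y] sym[of f y] sym[of f e] power2_eq_square algebra_simps)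
  also have "\<dots> \<le> 0"
    using det by (intro mult_nonpos_nonneg) auto
  finally show "B x x * B y y \<le> (B x y)\<^sup>2" by simp
qed

section \<open>Directional shifts of coefficient functions\<close>

text \<open>A directional derivative seen on coefficients: for a normalized series with coefficients
  \<open>c (\<delta> - \<mu>)\<close>, differentiating in the variable i replaces \<open>c w\<close>
  by \<open>c (w - \<epsilon>\<^sub>i)\<close>, without numerical factors.\<close>

definition dir_shift :: "nat \<Rightarrow> (nat \<Rightarrow> real) \<Rightarrow> ((nat \<Rightarrow>\<^sub>0 int) \<Rightarrow> real) \<Rightarrow> ((nat \<Rightarrow>\<^sub>0 int) \<Rightarrow> real)" where
  "dir_shift m x c = (\<lambda>w. \<Sum>i\<in>{1..m}. x i * c (w - Poly_Mapping.single i 1))"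

lemma dir_shift_commute: "dir_shift m x (dir_shift m y c) = dir_shift m y (dir_shift m x c)"
proof
  fix w
  have "dir_shift m x (dir_shift m y c) w =
    (\<Sum>i\<in>{1..m}. \<Sum>j\<in>{1..m}. x i * (y j * c (w - Poly_Mapping.single i 1 - Poly_Mapping.single j 1)))"
    by (simp add: dir_shift_def sum_distrib_left)
  also have "\<dots> = dir_shift m y (dir_shift m x c) w"
    by (subst sum.swap) (simp add: dir_shift_def sum_distrib_left mult.left_commute cancel_ab_semigroup_add_class.diff_right_commute)
  finally show "dir_shift m x (dir_shift m y c) w = dir_shift m y (dir_shift m x c) w" .
qed

lemma foldr_dir_shift_commute:
  "foldr (dir_shift m) xs (dir_shift m x c) = dir_shift m x (foldr (dir_shift m) xs c)"
  by (induction xs) (simp_all add: dir_shift_commute)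

lemma foldr_dir_shift_translate:
  "foldr (dir_shift m) xs (\<lambda>w. c (w - s)) = (\<lambda>w. foldr (dir_shift m) xs c (w - s))"
  by (induction xs) (simp_all add: dir_shift_def cancel_ab_semigroup_add_class.diff_right_commute)

lemma dir_shift_cong:
  "(\<And>i. i \<in> {1..m} \<Longrightarrow> x i = y i) \<Longrightarrow> dir_shift m x c = dir_shift m y c"
  by (simp add: dir_shift_def)

lemma dir_shift_sum:
  "dir_shift m (\<lambda>i. \<Sum>e\<in>A. s e * d e i) c w = (\<Sum>e\<in>A. s e * dir_shift m (d e) c w)"
  unfolding dir_shift_def sum_distrib_left sum_distrib_right
  by (subst sum.swap) (simp add: mult_ac)

lemma dir_shift_diff:
  "dir_shift m (\<lambda>i. \<alpha> * x i - \<beta> * y i) c w = \<alpha> * dir_shift m x c w - \<beta> * dir_shift m y c w"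
  by (simp add: dir_shift_def sum_distrib_left sum_subtractf algebra_simps)

lemma dir_shift_unit:
  assumes "k \<in> {1..m}"
  shows "dir_shift m (\<lambda>i. of_bool (i = k)) c w = c (w - Poly_Mapping.single k 1)"
proof -
  have "dir_shift m (\<lambda>i. of_bool (i = k)) c w
    = (\<Sum>i\<in>{1..m}. if i = k then c (w - Poly_Mapping.single i 1) else 0)"
    unfolding dir_shift_def by (intro sum.cong) auto
  then show ?thesis using assms by simp
qed

lemma dir_shift_units:
  "dir_shift m x c w = (\<Sum>k\<in>{1..m}. x k * dir_shift m (\<lambda>i. of_bool (i = k)) c w)"
  by (subst dir_shift_def) (intro sum.cong refl, simp only: dir_shift_unit)

lemma foldr_dir_shift_nonneg:
  assumes "\<And>w. c w \<ge> 0" and "\<And>x k. x \<in> set xs \<Longrightarrow> k \<in> {1..m} \<Longrightarrow> x k \<ge> 0"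
  shows "foldr (dir_shift m) xs c w \<ge> 0"
  using assms(2)
proof (induction xs arbitrary: w)
  case Nil
  then show ?case using assms(1) by simp
next
  case (Cons x xs)
  then show ?case by (auto simp: dir_shift_def intro!: sum_nonneg)
qed

text \<open>Since w is nonnegative with coordinate sum \<open>length xs\<close>, some sequence of
  unit steps leads from w exactly to 0. It contributes a positive multiple of \<open>c 0\<close>,
  and no other summand is negative.\<close>

lemma foldr_dir_shift_pos:
  assumes c: "\<And>w. c w \<ge> 0" "c 0 > 0"
    and "\<And>x k. x \<in> set xs \<Longrightarrow> k \<in> {1..m} \<Longrightarrow> x k > 0"
    and "\<And>k. Poly_Mapping.lookup w k \<ge> 0" "Poly_Mapping.keys w \<subseteq> {1..m}"
    and "(\<Sum>k\<in>{1..m}. Poly_Mapping.lookup w k) = int (length xs)"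
  shows "foldr (dir_shift m) xs c w > 0"
  using assms(3-)
proof (induction xs arbitrary: w)
  case Nil
  have "Poly_Mapping.lookup w k = 0" for k
  proof (cases "k \<in> {1..m}")
    case True
    have "\<forall>k\<in>{1..m}. Poly_Mapping.lookup w k = 0"
      using Nil by (subst sum_nonneg_eq_0_iff[symmetric]) auto
    then show ?thesis using True by blast
  next
    case False
    then show ?thesis using Nil(3) by (meson in_keys_iff subsetD)
  qed
  then have "w = 0" by (intro poly_mapping_eqI) simp
  then show ?case using c by simp
next
  case (Cons x xs)
  have "\<exists>i\<in>{1..m}. Poly_Mapping.lookup w i > 0"
  proof (rule ccontr)
    assume "\<not> ?thesis"
    then have "(\<Sum>k\<in>{1..m}. Poly_Mapping.lookup w k) \<le> 0" by (intro sum_nonpos) (auto simp: not_less)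
    then show False using Cons.prems(4) by simp
  qed
  then obtain i where i: "i \<in> {1..m}" "Poly_Mapping.lookup w i > 0" by blast
  let ?w = "w - Poly_Mapping.single i 1"
  have lk: "Poly_Mapping.lookup ?w k = Poly_Mapping.lookup w k - (if k = i then 1 else 0)" for k
    by (simp add: lookup_minus lookup_single)
  have "foldr (dir_shift m) xs c ?w > 0"
  proof (rule Cons.IH)
    show "Poly_Mapping.lookup ?w k \<ge> 0" for k
      using Cons.prems(2)[of k] i by (simp add: lk)
    show "Poly_Mapping.keys ?w \<subseteq> {1..m}"
      using Cons.prems(3) i by (force simp: in_keys_iff lk split: if_splits)
    show "(\<Sum>k\<in>{1..m}. Poly_Mapping.lookup ?w k) = int (length xs)"
      using Cons.prems(4) i by (simp add: lk sum_subtractf)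
  qed (use Cons.prems in auto)
  moreover have "foldr (dir_shift m) xs c (w - Poly_Mapping.single k 1) \<ge> 0" for k
    by (rule foldr_dir_shift_nonneg) (use c Cons.prems(1) in \<open>auto intro: less_imp_le\<close>)
  moreover have "x k > 0" if "k \<in> {1..m}" for k using Cons.prems(1) that by simp
  ultimately show ?case
    unfolding foldr_Cons o_apply using i
    by (subst dir_shift_def) (auto simp: less_imp_le intro!: sum_pos2[of _ i])
qed

lemma tendsto_dir_shift:
  assumes "\<And>w. ((\<lambda>\<eta>. c \<eta> w) \<longlongrightarrow> c' w) F" and "\<And>k. ((\<lambda>\<eta>. x \<eta> k) \<longlongrightarrow> x' k) F"
  shows "((\<lambda>\<eta>. dir_shift m (x \<eta>) (c \<eta>) w) \<longlongrightarrow> dir_shift m x' c' w) F"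
  unfolding dir_shift_def by (intro tendsto_intros assms)

section \<open>Positive eigenvalues of a symmetric matrix\<close>

lemma symmetric_bilinear:
  fixes A :: "'a :: comm_ring_1 mat"
  assumes A: "A \<in> carrier_mat n n" "A\<^sup>T = A" and "v \<in> carrier_vec n" "w \<in> carrier_vec n"
  shows "v \<bullet> (A *\<^sub>v w) = (A *\<^sub>v v) \<bullet> w"
proof -
  have "v \<bullet> (A *\<^sub>v w) = (A\<^sup>T *\<^sub>v v) \<bullet> w"
    using transpose_vec_mult_scalar[OF A(1) assms(4,3)]
    by simp
  then show ?thesis using A(2) by simp
qed

text \<open>Deflation: in an orthogonal basis starting with v the matrix is block triangular with
  first entry a, so the double root leaves a as an eigenvalue of the block \<open>A3\<close>. Its
  eigenvector is lifted back and made orthogonal to v.\<close>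

lemma symmetric_double_eigenvalue:
  fixes A :: "real mat"
  assumes A: "A \<in> carrier_mat n n" and sym: "A\<^sup>T = A"
    and ord: "Polynomial.order a (char_poly A) \<ge> 2"
  obtains v w where "eigenvector A v a" "eigenvector A w a" "v \<bullet> w = 0"
proof -
  have cp0: "char_poly A \<noteq> 0"
    using degree_monic_char_poly[OF A] by auto
  have "poly (char_poly A) a = 0"
    using ord cp0 by (simp add: order_root)
  then have ev: "eigenvalue A a"
    by (simp add: eigenvalue_root_char_poly[OF A])
  then have n: "n \<noteq> 0" using eigenvalue_imp_nonzero_dim[OF A] by blast
  obtain v where ev: "eigenvector A v a"
    using ev by (auto simp: eigenvalue_def)
  then have v: "v \<in> carrier_vec n" and v0: "v \<noteq> 0\<^sub>v n" and Av: "A *\<^sub>v v = a \<cdot>\<^sub>v v"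
    using A by (auto simp: eigenvector_def)
  interpret cof_vec_space n "TYPE(real)" .
  define b where "b = basis_completion v"
  define ws where "ws = gram_schmidt n b"
  define W where "W = mat_of_cols n ws"
  define W' where "W' = corthogonal_inv W"
  define A' where "A' = W' * A * W"
  from basis_completion[OF v v0, folded b_def]
  have dist_b: "distinct b" and indep: "\<not> lin_dep (set b)" and b: "set b \<subseteq> carrier_vec n"
    and hdb: "hd b = v" and len_b: "length b = n" by auto
  from hdb len_b n obtain vs where bv: "b = v # vs" by (cases b) auto
  from gram_schmidt_result[OF b dist_b indep refl, folded ws_def]
  have ws: "set ws \<subseteq> carrier_vec n" "corthogonal ws" "length ws = n"
    by (auto simp: len_b)
  from gram_schmidt_hd[OF v, of vs, folded bv] have hdws: "hd ws = v" unfolding ws_def .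
  have orth_W: "corthogonal_mat W" using orthogonal_mat_of_cols ws unfolding W_def .
  have W: "W \<in> carrier_mat n n"
    using ws unfolding W_def using mat_of_cols_carrier(1)[of n ws] by auto
  have W': "W' \<in> carrier_mat n n"
    unfolding W'_def corthogonal_inv_def using W by (auto simp: mat_of_rows_def)
  from corthogonal_inv_result[OF orth_W] have "inverts_mat W' W" unfolding W'_def .
  then have W'W: "W' * W = 1\<^sub>m n" using W' by (simp add: inverts_mat_def)
  then have WW': "W * W' = 1\<^sub>m n" using mat_mult_left_right_inverse[OF W' W] by simp
  have A': "A' \<in> carrier_mat n n" using W W' A unfolding A'_def by auto
  have AW: "A * W = W * A'"
  proof -
    have "W * A' = (W * W') * (A * W)"
      unfolding A'_def using W W' A by (simp add: assoc_mult_mat[of _ n n _ n _ n])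
    then show ?thesis using WW' A W by simp
  qed
  have "similar_mat A' A"
    by (rule similar_matI[of _ _ W' W n]) (use W W' A A' W'W WW' in \<open>auto simp: A'_def\<close>)
  then have cpA': "char_poly A' = char_poly A" by (rule char_poly_similar)
  have col0: "col A' 0 = vec n (\<lambda>i. if i = 0 then a else 0)"
    unfolding A'_def W'_def W_def
    by (rule corthogonal_col_ev_0[OF A v v0 Av n hdws ws])
  obtain A1 A2 A0 A3 where split: "split_block A' 1 1 = (A1,A2,A0,A3)"
    by (cases "split_block A' 1 1") auto
  let ?n = "n - 1"
  from A' n have "dim_row A' = 1 + ?n" "dim_col A' = 1 + ?n" by auto
  from split_block[OF split this] have A2: "A2 \<in> carrier_mat 1 ?n"
    and A3: "A3 \<in> carrier_mat ?n ?n" and A'block: "A' = four_block_mat A1 A2 A0 A3" by auto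
  have A1: "A1 = mat 1 1 (\<lambda>_. a)"
    using split[unfolded split_block_def Let_def] arg_cong[OF col0, of "\<lambda>v. v $ 0"] A' n
    by (auto simp: col_def)
  have A'0: "A' $$ (Suc i, 0) = 0" if "i < ?n" for i
    using that arg_cong[OF col0, of "\<lambda>v. v $ Suc i"] A' by auto
  have A0: "A0 = 0\<^sub>m ?n 1"
    using split[unfolded split_block_def Let_def] A'0 A' by auto
  have "char_poly A = char_poly A1 * char_poly A3"
    unfolding cpA'[symmetric] A'block A0
    by (rule char_poly_four_block_zeros_col) (use A1 A2 A3 in auto)
  moreover have "char_poly A1 = [:- a, 1:]"
    by (simp add: A1 char_poly_defs det_def sign_def)
  ultimately have cp: "char_poly A = [:- a, 1:] * char_poly A3" by simp
  have "Polynomial.order a (char_poly A) = Polynomial.order a [:- a, 1:] + Polynomial.order a (char_poly A3)"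
    unfolding cp by (rule order_mult) (use cp cp0 in simp)
  moreover have "Polynomial.order a [:- a, 1:] = 1"
    using order_power_n_n[of a 1] by simp
  ultimately have "Polynomial.order a (char_poly A3) \<noteq> 0"
    using ord by simp
  then have "eigenvalue A3 a"
    by (simp add: eigenvalue_root_char_poly[OF A3] order_root)
  then obtain z where z: "z \<in> carrier_vec ?n" "z \<noteq> 0\<^sub>v ?n" "A3 *\<^sub>v z = a \<cdot>\<^sub>v z"
    using A3 by (auto simp: eigenvalue_def eigenvector_def)
  define u where "u = 0\<^sub>v 1 @\<^sub>v z"
  define w where "w = W *\<^sub>v u"
  define c where "c = (A2 *\<^sub>v z) $ 0"
  have u: "u \<in> carrier_vec n"
    using z(1) n by (auto simp: u_def intro!: carrier_vecI)
  have w: "w \<in> carrier_vec n" using W u by (simp add: w_def)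
  have A'u: "A' *\<^sub>v u = a \<cdot>\<^sub>v u + c \<cdot>\<^sub>v unit_vec n 0"
  proof -
    have "A' *\<^sub>v u = (A1 *\<^sub>v 0\<^sub>v 1 + A2 *\<^sub>v z) @\<^sub>v (A0 *\<^sub>v 0\<^sub>v 1 + A3 *\<^sub>v z)"
      unfolding A'block u_def
      by (rule four_block_mat_mult_vec[of _ 1 1 _ ?n _ ?n]) (use A1 A2 A0 A3 z in auto)
    also have "\<dots> = a \<cdot>\<^sub>v u + c \<cdot>\<^sub>v unit_vec n 0"
      by (rule eq_vecI) (use A1 A2 A0 A3 z n in \<open>auto simp: u_def c_def\<close>)
    finally show ?thesis .
  qed
  have We: "W *\<^sub>v unit_vec n 0 = v"
  proof -
    have "ws ! 0 = v" using hdws ws(3) n by (cases ws) auto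
    then have "col W 0 = v" unfolding W_def using ws n v by (subst col_mat_of_cols) auto
    moreover have "W *\<^sub>v unit_vec n 0 = col W 0"
      by (rule eq_vecI) (use W n in \<open>auto simp: scalar_prod_right_unit[of _ n]\<close>)
    ultimately show ?thesis by simp
  qed
  have Aw: "A *\<^sub>v w = a \<cdot>\<^sub>v w + c \<cdot>\<^sub>v v"
  proof -
    have "A *\<^sub>v w = W *\<^sub>v (A' *\<^sub>v u)"
      unfolding w_def using A W A' u AW by (metis assoc_mult_mat_vec)
    also have "\<dots> = W *\<^sub>v (a \<cdot>\<^sub>v u) + W *\<^sub>v (c \<cdot>\<^sub>v unit_vec n 0)"
      unfolding A'u using W u by (intro mult_add_distrib_mat_vec) auto
    also have "\<dots> = a \<cdot>\<^sub>v w + c \<cdot>\<^sub>v v"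
      using W u by (simp add: mult_mat_vec[of _ n n] w_def We)
    finally show ?thesis .
  qed
  \<comment> \<open>The basis is orthogonal but not normalized, so \<open>A'\<close> need not be
    symmetric and its row \<open>A2\<close> could leave a Jordan term \<open>c\<close> times v.
    Symmetry of A itself, tested against v, removes it.\<close>
  have "v \<bullet> (A *\<^sub>v w) = a * (v \<bullet> w) + c * (v \<bullet> v)"
    unfolding Aw using v w by (simp add: scalar_prod_add_distrib[of _ n])
  moreover have "v \<bullet> (A *\<^sub>v w) = a * (v \<bullet> w)"
    using symmetric_bilinear[OF A sym v w] v w by (simp add: Av)
  moreover have vv: "v \<bullet> v > 0"
    using v v0 by (simp add: conjugate_square_greater_0_vec[of v n, simplified])
  ultimately have c0: "c = 0" by simp
  have Aw': "A *\<^sub>v w = a \<cdot>\<^sub>v w"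
    using Aw v w c0 by simp
  define s where "s = (v \<bullet> w) / (v \<bullet> v)"
  define w' where "w' = w - s \<cdot>\<^sub>v v"
  have w': "w' \<in> carrier_vec n" using v w by (simp add: w'_def)
  \<comment> \<open>In the basis W, v is the first unit vector while w has first coordinate 0; a
    multiple of v equal to w would force \<open>z = 0\<close>.\<close>
  have "w' \<noteq> 0\<^sub>v n"
  proof
    assume 0: "w' = 0\<^sub>v n"
    have w_eq: "w = s \<cdot>\<^sub>v v"
    proof (rule eq_vecI)
      fix i assume "i < dim_vec (s \<cdot>\<^sub>v v)"
      then show "w $ i = (s \<cdot>\<^sub>v v) $ i"
        using arg_cong[OF 0, of "\<lambda>x. x $ i"] v w by (simp add: w'_def)
    qed (use v w in simp)
    have "W' *\<^sub>v (W *\<^sub>v x) = x" if "x \<in> carrier_vec n" for x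
      using W W' that W'W assoc_mult_mat_vec[of W' n n W n x] by simp
    then have "u = W' *\<^sub>v w" "W' *\<^sub>v v = unit_vec n 0"
      using u We by (auto simp: w_def)
    then have "u = s \<cdot>\<^sub>v unit_vec n 0"
      using W' v by (simp add: w_eq mult_mat_vec[of _ n n])
    then have u_Suc: "u $ Suc i = 0" if "i < ?n" for i
      using that by simp
    have "z = 0\<^sub>v ?n"
    proof (rule eq_vecI)
      fix i assume "i < dim_vec (0\<^sub>v ?n :: real vec)"
      then have i: "i < ?n" by simp
      then show "z $ i = 0\<^sub>v ?n $ i"
        using u_Suc[OF i] z(1) by (simp add: u_def)
    qed (use z in simp)
    then show False using z by simp
  qed
  moreover have "A *\<^sub>v w' = a \<cdot>\<^sub>v w'"
  proof -
    have "A *\<^sub>v w' = A *\<^sub>v w - s \<cdot>\<^sub>v (A *\<^sub>v v)"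
      unfolding w'_def using A v w by (simp add: mult_minus_distrib_mat_vec[of _ n n] mult_mat_vec[of _ n n])
    also have "\<dots> = a \<cdot>\<^sub>v w'"
      unfolding w'_def Aw' Av by (rule eq_vecI) (use v w in \<open>auto simp: algebra_simps\<close>)
    finally show ?thesis .
  qed
  ultimately have "eigenvector A w' a"
    using A w' by (auto simp: eigenvector_def)
  moreover have "v \<bullet> w' = 0"
    using v w vv by (simp add: w'_def scalar_prod_minus_distrib[of _ n] s_def)
  ultimately show thesis using that ev by blast
qed

text \<open>Two orthogonal eigenvectors with positive eigenvalues would make the left side of
  \<open>hyp\<close> positive and the right side zero. Distinct eigenvalues have orthogonal
  eigenvectors by symmetry; a repeated one has them by deflation.\<close>

lemma num_pos_eigenvalues_le_1:
  fixes A :: "real mat"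
  assumes A: "A \<in> carrier_mat n n" and sym: "A\<^sup>T = A"
    and hyp: "\<And>x y. x \<in> carrier_vec n \<Longrightarrow> y \<in> carrier_vec n \<Longrightarrow> y \<bullet> (A *\<^sub>v y) > 0 \<Longrightarrow>
      (x \<bullet> (A *\<^sub>v x)) * (y \<bullet> (A *\<^sub>v y)) \<le> (x \<bullet> (A *\<^sub>v y))\<^sup>2"
  shows "num_pos_eigenvalues A \<le> 1"
proof -
  have pos: "v \<bullet> v > 0" "v \<bullet> (A *\<^sub>v w) = b * (v \<bullet> w)"
    if "eigenvector A v a" "eigenvector A w b" for v w a b
  proof -
    show "v \<bullet> v > 0"
      using A that conjugate_square_greater_0_vec[of v n] by (simp add: eigenvector_def)
    show "v \<bullet> (A *\<^sub>v w) = b * (v \<bullet> w)"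
      using A that by (auto simp: eigenvector_def)
  qed
  have no_orth: False
    if ev: "eigenvector A v a" "eigenvector A w b" and ab: "a > 0" "b > 0" and vw: "v \<bullet> w = 0"
    for v w a b
  proof -
    have "(v \<bullet> (A *\<^sub>v v)) * (w \<bullet> (A *\<^sub>v w)) \<le> (v \<bullet> (A *\<^sub>v w))\<^sup>2"
      by (rule hyp) (use A ev ab pos(1)[OF ev(2,1)] pos(2)[OF ev(2,2)] in \<open>auto simp: eigenvector_def\<close>)
    moreover have "v \<bullet> (A *\<^sub>v w) = 0" using pos(2)[OF ev] vw by simp
    moreover have "(v \<bullet> (A *\<^sub>v v)) * (w \<bullet> (A *\<^sub>v w)) > 0"
      using ab pos(1)[OF ev] pos(1)[OF ev(2,1)] pos(2)[OF ev(1,1)] pos(2)[OF ev(2,2)] by simp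
    ultimately show False by simp
  qed
  have order_le: "Polynomial.order a (char_poly A) \<le> 1" if "a > 0" for a
  proof (rule ccontr)
    assume "\<not> ?thesis"
    then have "Polynomial.order a (char_poly A) \<ge> 2" by simp
    then obtain v w where "eigenvector A v a" "eigenvector A w a" "v \<bullet> w = 0"
      using symmetric_double_eigenvalue[OF A sym] by blast
    then show False using no_orth that by blast
  qed
  have unique: "a = b" if eva: "eigenvalue A a" "a > 0" "eigenvalue A b" "b > 0" for a b
  proof (rule ccontr)
    assume "a \<noteq> b"
    obtain v w where ev: "eigenvector A v a" "eigenvector A w b"
      using eva unfolding eigenvalue_def by blast
    have carr: "v \<in> carrier_vec n" "w \<in> carrier_vec n"
      using ev A by (auto simp: eigenvector_def)
    have "b * (v \<bullet> w) = a * (v \<bullet> w)"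
      using pos(2)[OF ev] symmetric_bilinear[OF A sym carr] ev(1) carr by (auto simp: eigenvector_def)
    then have "v \<bullet> w = 0" using \<open>a \<noteq> b\<close> by simp
    then show False using no_orth[OF ev eva(2,4)] by blast
  qed
  show ?thesis
  proof (cases "{a. eigenvalue A a \<and> a > 0} = {}")
    case True
    show ?thesis unfolding num_pos_eigenvalues_def True by simp
  next
    case False
    then obtain a where "eigenvalue A a" "a > 0" by blast
    then have eq: "{a. eigenvalue A a \<and> a > 0} = {a}" using unique by blast
    show ?thesis unfolding num_pos_eigenvalues_def eq using order_le[OF \<open>a > 0\<close>] by simp
  qed
qed

section \<open>Kostant partition functions\<close>

lemma increasing_multidigraphD:
  assumes "increasing_multidigraph m G"
  shows "finite (arcs G)"
    and "e \<in> arcs G \<Longrightarrow> tail G e \<in> {1..m}"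
    and "e \<in> arcs G \<Longrightarrow> head G e \<in> {1..m}"
    and "e \<in> arcs G \<Longrightarrow> tail G e < head G e"
  using assms fin_digraph.finite_arcs[of G] wf_digraph.tail_in_verts[of G]
    wf_digraph.head_in_verts[of G] loopfree_digraph.axioms(1)[of G]
  by (auto simp: increasing_multidigraph_def)

definition net_flow :: "(nat, 'e) pre_digraph \<Rightarrow> ('e \<Rightarrow> nat) \<Rightarrow> nat \<Rightarrow>\<^sub>0 int" where
  "net_flow G f = (\<Sum>e\<in>arcs G. Poly_Mapping.single (tail G e) (int (f e))
                    - Poly_Mapping.single (head G e) (int (f e)))"

lemma kostant_flows_alt: "kostant_flows G v = {f \<in> arcs G \<rightarrow>\<^sub>E UNIV. net_flow G f = v}"
  by (simp add: kostant_flows_def net_flow_def)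

lemma net_flow_remove:
  assumes "finite (arcs G)" "e \<in> arcs G"
  shows "net_flow G f = net_flow (G\<lparr>arcs := arcs G - {e}\<rparr>) f
    + (Poly_Mapping.single (tail G e) (int (f e)) - Poly_Mapping.single (head G e) (int (f e)))"
  using sum.remove[OF assms] by (simp add: net_flow_def add.commute)

lemma net_flow_cong: "(\<And>e. e \<in> arcs G \<Longrightarrow> f e = g e) \<Longrightarrow> net_flow G f = net_flow G g"
  by (simp add: net_flow_def)

lemma net_flow_upd:
  assumes "finite (arcs G)" "e \<in> arcs G"
  shows "net_flow G (f(e := k)) = net_flow G f
    + Poly_Mapping.single (tail G e) (int k - int (f e)) - Poly_Mapping.single (head G e) (int k - int (f e))"
proof -
  have "net_flow (G\<lparr>arcs := arcs G - {e}\<rparr>) (f(e := k)) = net_flow (G\<lparr>arcs := arcs G - {e}\<rparr>) f"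
    by (rule net_flow_cong) simp
  then show ?thesis
    unfolding net_flow_remove[OF assms, of f] net_flow_remove[OF assms, of "f(e := k)"]
    by (simp add: single_diff algebra_simps)
qed

text \<open>Splits the flows according to whether they use \<open>e\<close>.\<close>

lemma kostant_arc_recursion:
  fixes G :: "(nat, 'e) pre_digraph"
  assumes fin: "finite (arcs G)" and fin_flows: "\<And>v. finite (kostant_flows G v)" and e: "e \<in> arcs G"
  shows "kostant G v = kostant (G\<lparr>arcs := arcs G - {e}\<rparr>) v
    + kostant G (v - Poly_Mapping.single (tail G e) 1 + Poly_Mapping.single (head G e) 1)"
proof -
  let ?H = "G\<lparr>arcs := arcs G - {e}\<rparr>"
  let ?v = "v - Poly_Mapping.single (tail G e) 1 + Poly_Mapping.single (head G e) 1"
  let ?Z = "{f \<in> kostant_flows G v. f e = 0}" and ?P = "{f \<in> kostant_flows G v. f e \<noteq> 0}"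
  have "card ?Z = kostant ?H v"
    unfolding kostant_def
  proof (rule bij_betw_same_card[of "\<lambda>f. f(e := undefined)"], rule bij_betwI[where g = "\<lambda>f. f(e := 0)"])
    show "(\<lambda>f. f(e := undefined)) \<in> ?Z \<rightarrow> kostant_flows ?H v"
    proof
      fix f assume f: "f \<in> ?Z"
      have "net_flow ?H (f(e := undefined)) = net_flow ?H f" by (rule net_flow_cong) simp
      then show "f(e := undefined) \<in> kostant_flows ?H v"
        using f net_flow_remove[OF fin e, of f] by (auto simp: kostant_flows_alt PiE_iff extensional_def)
    qed
    show "(\<lambda>f. f(e := 0)) \<in> kostant_flows ?H v \<rightarrow> ?Z"
    proof
      fix f assume f: "f \<in> kostant_flows ?H v"
      have "net_flow ?H (f(e := 0)) = net_flow ?H f" by (rule net_flow_cong) simp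
      then show "f(e := 0) \<in> ?Z"
        using f e net_flow_remove[OF fin e, of "f(e := 0)"] by (auto simp: kostant_flows_alt PiE_iff extensional_def)
    qed
  qed (auto simp: kostant_flows_alt PiE_iff extensional_def)
  moreover have "card ?P = kostant G ?v"
    unfolding kostant_def
  proof (rule bij_betw_same_card[of "\<lambda>f. f(e := f e - 1)"], rule bij_betwI[where g = "\<lambda>f. f(e := f e + 1)"])
    show "(\<lambda>f. f(e := f e - 1)) \<in> ?P \<rightarrow> kostant_flows G ?v"
    proof
      fix f assume f: "f \<in> ?P"
      then have "int (f e - 1) - int (f e) = - 1" by auto
      then show "f(e := f e - 1) \<in> kostant_flows G ?v"
        using f e by (auto simp: kostant_flows_alt net_flow_upd[OF fin e] PiE_iff extensional_def single_uminus)
    qed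
    show "(\<lambda>f. f(e := f e + 1)) \<in> kostant_flows G ?v \<rightarrow> ?P"
      using e by (auto simp: kostant_flows_alt net_flow_upd[OF fin e] PiE_iff extensional_def)
  qed auto
  moreover have "kostant G v = card ?Z + card ?P"
    unfolding kostant_def
    by (subst card_Un_disjoint[symmetric]) (use fin_flows in \<open>auto intro!: arg_cong[of _ _ card]\<close>)
  ultimately show ?thesis by simp
qed

text \<open>Finiteness is what turns cardinality 0 into emptiness. Since \<open>net_flow\<close>
  ignores values off the arcs, a witness may be any total function, free of the
  \<open>undefined\<close> convention.\<close>

lemma kostant_eq_0_iff:
  fixes G :: "(nat, 'e) pre_digraph"
  assumes "increasing_multidigraph m G"
  shows "kostant G v = 0 \<longleftrightarrow> (\<forall>f. net_flow G f \<noteq> v)"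
proof -
  have "net_flow G (restrict f (arcs G)) = net_flow G f" for f
    by (rule net_flow_cong) simp
  moreover have "restrict f (arcs G) \<in> arcs G \<rightarrow>\<^sub>E UNIV" for f :: "'e \<Rightarrow> nat" by simp
  ultimately have "kostant_flows G v = {} \<longleftrightarrow> (\<forall>f. net_flow G f \<noteq> v)"
    unfolding kostant_flows_alt by (metis (mono_tags, lifting) empty_Collect_eq)
  then show ?thesis
    using finite_kostant_flows[OF assms] by (simp add: kostant_def)
qed

lemma kostant_0_pos:
  assumes "increasing_multidigraph m G"
  shows "kostant G 0 > 0"
proof -
  have "net_flow G (\<lambda>_. 0) = 0" by (simp add: net_flow_def)
  then show ?thesis using kostant_eq_0_iff[OF assms, where v = 0] by auto
qed

lemma lookup_net_flow:
  "Poly_Mapping.lookup (net_flow G f) k =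
    (\<Sum>e\<in>arcs G. (if tail G e = k then int (f e) else 0) - (if head G e = k then int (f e) else 0))"
  by (simp add: net_flow_def lookup_sum lookup_minus lookup_single when_def)

lemma keys_net_flow:
  assumes "increasing_multidigraph m G"
  shows "Poly_Mapping.keys (net_flow G f) \<subseteq> {1..m}"
proof
  fix k assume "k \<in> Poly_Mapping.keys (net_flow G f)"
  then have "Poly_Mapping.lookup (net_flow G f) k \<noteq> 0" by (simp add: in_keys_iff)
  then obtain e where "e \<in> arcs G" "tail G e = k \<or> head G e = k"
    unfolding lookup_net_flow by (force dest!: sum.not_neutral_contains_not_neutral split: if_splits)
  then show "k \<in> {1..m}" using increasing_multidigraphD[OF assms] by blast
qed

text \<open>A cut formula: an arc with both ends on one side of the cut above i cancels, and one
  crossing it brings its flow into the upper part. So the net flow of an upper segment is never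
  positive, and for \<open>i = 0\<close> nothing crosses.\<close>

lemma sum_net_flow_upper:
  assumes G: "increasing_multidigraph m G"
  shows "(\<Sum>k\<in>{i<..m}. Poly_Mapping.lookup (net_flow G f) k) =
    - (\<Sum>e\<in>arcs G. if tail G e \<le> i \<and> i < head G e then int (f e) else 0)"
proof -
  have "(\<Sum>k\<in>{i<..m}. Poly_Mapping.lookup (net_flow G f) k) =
    (\<Sum>e\<in>arcs G. (\<Sum>k\<in>{i<..m}. if tail G e = k then int (f e) else 0)
      - (\<Sum>k\<in>{i<..m}. if head G e = k then int (f e) else 0))"
    unfolding lookup_net_flow sum_subtractf[symmetric] by (rule sum.swap)
  also have "\<dots> = (\<Sum>e\<in>arcs G. - (if tail G e \<le> i \<and> i < head G e then int (f e) else 0))"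
  proof (intro sum.cong refl)
    fix e assume e: "e \<in> arcs G"
    have "tail G e < head G e" "tail G e \<le> m" "head G e \<le> m"
      using increasing_multidigraphD(2-4)[OF G e] by auto
    then show "(\<Sum>k\<in>{i<..m}. if tail G e = k then int (f e) else 0)
      - (\<Sum>k\<in>{i<..m}. if head G e = k then int (f e) else 0)
      = - (if tail G e \<le> i \<and> i < head G e then int (f e) else 0)"
      by simp
  qed
  finally show ?thesis by (simp add: sum_negf)
qed

lemma sum_net_flow:
  assumes G: "increasing_multidigraph m G"
  shows "(\<Sum>k\<in>{1..m}. Poly_Mapping.lookup (net_flow G f) k) = 0"
proof -
  have "(\<Sum>e\<in>arcs G. if tail G e \<le> 0 \<and> 0 < head G e then int (f e) else 0) = 0"
    using increasing_multidigraphD(2)[OF G] by (intro sum.neutral) force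
  moreover have "{1..m} = {0<..m}" by auto
  ultimately show ?thesis
    using sum_net_flow_upper[OF G, where i = 0 and f = f] by simp
qed

text \<open>Adjoining root arcs embeds the arcs of the graph into a sum type; this carries the
  partition function across.\<close>

lemma kostant_reindex:
  fixes G :: "(nat, 'e) pre_digraph" and H :: "(nat, 'f) pre_digraph"
  assumes inj: "inj_on \<phi> (arcs G)" and arcs: "arcs H = \<phi> ` arcs G"
    and "\<And>e. e \<in> arcs G \<Longrightarrow> tail H (\<phi> e) = tail G e"
    and "\<And>e. e \<in> arcs G \<Longrightarrow> head H (\<phi> e) = head G e"
  shows "kostant H v = kostant G v"
proof -
  define r where "r g = restrict (g \<circ> \<phi>) (arcs G)" for g :: "'f \<Rightarrow> nat"
  define s where "s f = restrict (f \<circ> inv_into (arcs G) \<phi>) (arcs H)" for f :: "'e \<Rightarrow> nat"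
  have net: "net_flow G (g \<circ> \<phi>) = net_flow H g" for g
    unfolding net_flow_def arcs by (simp add: sum.reindex[OF inj] assms(3,4))
  have net_r: "net_flow G (r g) = net_flow H g" for g
    unfolding net[symmetric] by (rule net_flow_cong) (simp add: r_def)
  have rs: "r (s f) = f" if "f \<in> arcs G \<rightarrow>\<^sub>E UNIV" for f
    using that inj by (auto simp: r_def s_def arcs PiE_iff extensional_def fun_eq_iff)
  have sr: "s (r g) = g" if "g \<in> arcs H \<rightarrow>\<^sub>E UNIV" for g
    using that inj by (auto simp: r_def s_def arcs PiE_iff extensional_def fun_eq_iff)
  have "bij_betw r (kostant_flows H v) (kostant_flows G v)"
  proof (rule bij_betwI[where g = s])
    show "s \<in> kostant_flows G v \<rightarrow> kostant_flows H v"
    proof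
      fix f assume f: "f \<in> kostant_flows G v"
      then have "r (s f) = f" using rs by (simp add: kostant_flows_alt)
      then show "s f \<in> kostant_flows H v"
        using f net_r[of "s f"] by (auto simp: kostant_flows_alt s_def)
    qed
  qed (use net_r rs sr in \<open>auto simp: kostant_flows_alt r_def\<close>)
  then show ?thesis
    unfolding kostant_def by (rule bij_betw_same_card)
qed

section \<open>Deletion of arcs and the Hodge-Riemann induction\<close>

text \<open>The positions are the least and the greatest element of the support, and they may
  coincide; a third element would push the sum to 3.\<close>

lemma two_positive_positions:
  fixes f :: "nat \<Rightarrow> nat"
  assumes fin: "finite S" and sum: "(\<Sum>k\<in>S. f k) = 2"
  obtains i j where "i \<in> S" "j \<in> S" "i \<le> j" "f j > 0"
    "\<And>k. k \<in> S \<Longrightarrow> k \<noteq> i \<Longrightarrow> k \<noteq> j \<Longrightarrow> f k = 0"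
proof -
  define T where "T = {k\<in>S. f k \<noteq> 0}"
  have "T \<noteq> {}"
  proof
    assume "T = {}"
    then have "(\<Sum>k\<in>S. f k) = 0" by (auto simp: T_def intro!: sum.neutral)
    then show False using sum by simp
  qed
  then have T: "finite T" "T \<noteq> {}"
    using fin by (auto simp: T_def)
  show thesis
  proof (rule that[of "Min T" "Max T"])
    show "Min T \<in> S" "Max T \<in> S" "Min T \<le> Max T" "f (Max T) > 0"
      using Min_in[OF T] Max_in[OF T] Min_le[OF T(1) Max_in[OF T]] by (auto simp: T_def)
    fix k assume k: "k \<in> S" "k \<noteq> Min T" "k \<noteq> Max T"
    show "f k = 0"
    proof (rule ccontr)
      assume fk: "f k \<noteq> 0"
      then have "Min T \<le> k" "k \<le> Max T" using k T by (auto simp: T_def)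
      then have "Min T \<noteq> Max T" using k by linarith
      then have "card {Min T, Max T, k} = 3" using k by simp
      moreover have "{Min T, Max T, k} \<subseteq> T"
        using Min_in[OF T] Max_in[OF T] k fk by (auto simp: T_def)
      moreover have "card T \<le> (\<Sum>k\<in>T. f k)"
        using sum_mono[of T "\<lambda>_. 1" f] by (simp add: T_def Suc_le_eq)
      moreover have "(\<Sum>k\<in>T. f k) \<le> (\<Sum>k\<in>S. f k)"
        by (rule sum_mono2) (use fin in \<open>auto simp: T_def\<close>)
      ultimately show False
        using sum card_mono[OF T(1), of "{Min T, Max T, k}"] by simp
    qed
  qed
qed

locale rooted_arcs =
  fixes m :: nat and src tgt :: "'o \<Rightarrow> nat"
begin

definition admissible :: "'o set \<Rightarrow> bool" where
  "admissible A \<longleftrightarrow> finite A \<and> (\<forall>e\<in>A. src e < tgt e \<and> tgt e \<le> m)"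

text \<open>This lets every vertex drain back to the root, so the directions positively span; it
  also makes the weight nonnegative on \<open>{1..m}\<close>.\<close>

definition covered :: "'o set \<Rightarrow> bool" where
  "covered A \<longleftrightarrow> (\<forall>k\<in>{1..m}. \<exists>e\<in>A. tgt e = k)"

text \<open>Vertex 0 is an auxiliary root: arcs leaving it carry no flow, but they count in the weight.\<close>

definition inner_graph :: "'o set \<Rightarrow> (nat, 'o) pre_digraph" where
  "inner_graph A = \<lparr>verts = {1..m}, arcs = {e\<in>A. src e \<noteq> 0}, tail = src, head = tgt\<rparr>"

definition coeff :: "'o set \<Rightarrow> (nat \<Rightarrow>\<^sub>0 int) \<Rightarrow> real" where
  "coeff A w = real (kostant (inner_graph A) w)"

text \<open>The in-degree vector minus one at each vertex, the shift that occurs in the Lidskii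
  volume formula for flow polytopes.\<close>

definition weight :: "'o set \<Rightarrow> nat \<Rightarrow>\<^sub>0 int" where
  "weight A = (\<Sum>e\<in>A. Poly_Mapping.single (tgt e) 1) - (\<Sum>k\<in>{1..m}. Poly_Mapping.single k 1)"

text \<open>For an arc out of the root this acts as a unit vector, because coordinate 0 is never
  summed.\<close>

definition direction :: "'o \<Rightarrow> nat \<Rightarrow> real" where
  "direction e i = of_bool (i = tgt e) - of_bool (i = src e)"

text \<open>For \<open>card A - m\<close> directions this is the polarized Lidskii formula: a
  normalized mixed volume of polytopes of flows that route the supplies \<open>xs\<close> to the
  root.\<close>

definition mixed :: "'o set \<Rightarrow> (nat \<Rightarrow> real) list \<Rightarrow> real" where
  "mixed A xs = foldr (dir_shift m) xs (coeff A) (weight A)"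

lemma admissible_remove: "admissible A \<Longrightarrow> admissible (A - B)"
  by (auto simp: admissible_def)

lemma inner_graph_simps [simp]:
  "arcs (inner_graph A) = {e\<in>A. src e \<noteq> 0}" "tail (inner_graph A) = src" "head (inner_graph A) = tgt"
  by (simp_all add: inner_graph_def)

lemma increasing_inner_graph:
  assumes "admissible A"
  shows "increasing_multidigraph m (inner_graph A)"
proof -
  have "fin_digraph (inner_graph A)" "loopfree_digraph (inner_graph A)"
    using assms by (unfold_locales; force simp: inner_graph_def admissible_def)+
  then show ?thesis
    using assms by (auto simp: increasing_multidigraph_def inner_graph_def admissible_def)
qed

lemma coeff_nonneg: "coeff A w \<ge> 0"
  by (simp add: coeff_def)

lemma mixed_swap: "mixed A (x # y # xs) = mixed A (y # x # xs)"
  by (simp add: mixed_def dir_shift_commute)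

lemma mixed_cong: "(\<And>k. k \<in> {1..m} \<Longrightarrow> x k = y k) \<Longrightarrow> mixed A (x # xs) = mixed A (y # xs)"
  unfolding mixed_def foldr_Cons o_apply using dir_shift_cong[of m x y] by metis

lemma mixed_sum: "mixed A ((\<lambda>i. \<Sum>e\<in>I. s e * d e i) # xs) = (\<Sum>e\<in>I. s e * mixed A (d e # xs))"
  by (simp add: mixed_def dir_shift_sum)

lemma mixed_diff: "mixed A ((\<lambda>i. \<alpha> * x i - \<beta> * y i) # xs) = \<alpha> * mixed A (x # xs) - \<beta> * mixed A (y # xs)"
  by (simp add: mixed_def dir_shift_diff)

text \<open>The deletion rule that drives the induction.\<close>

lemma mixed_direction:
  assumes A: "admissible A" and e: "e \<in> A"
  shows "mixed A (direction e # xs) = mixed (A - {e}) xs"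
proof -
  let ?t = "Poly_Mapping.single (tgt e) 1" and ?s = "Poly_Mapping.single (src e) 1"
  have e': "src e < tgt e" "tgt e \<le> m" using assms by (auto simp: admissible_def)
  have "dir_shift m (direction e) (coeff A) w = coeff (A - {e}) (w - ?t)" for w
  proof -
    have "dir_shift m (direction e) (coeff A) w
        = dir_shift m (\<lambda>i. of_bool (i = tgt e)) (coeff A) w - dir_shift m (\<lambda>i. of_bool (i = src e)) (coeff A) w"
      unfolding direction_def
      using dir_shift_diff[of m 1 "\<lambda>i. of_bool (i = tgt e)" 1 "\<lambda>i. of_bool (i = src e)" "coeff A" w]
      by simp
    moreover have "dir_shift m (\<lambda>i. of_bool (i = tgt e)) (coeff A) w = coeff A (w - ?t)"
      using e' by (intro dir_shift_unit) auto
    moreover have "dir_shift m (\<lambda>i. of_bool (i = src e)) (coeff A) w = (if src e = 0 then 0 else coeff A (w - ?s))"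
    proof (cases "src e = 0")
      case True
      then show ?thesis by (auto simp: dir_shift_def intro!: sum.neutral)
    next
      case False
      then show ?thesis using e' by (simp add: dir_shift_unit)
    qed
    moreover have "coeff A (w - ?t) = coeff (A - {e}) (w - ?t) + (if src e = 0 then 0 else coeff A (w - ?s))"
    proof (cases "src e = 0")
      case True
      then have "inner_graph A = inner_graph (A - {e})" by (auto simp: inner_graph_def)
      then show ?thesis using True by (simp add: coeff_def)
    next
      case False
      have "(inner_graph A)\<lparr>arcs := arcs (inner_graph A) - {e}\<rparr> = inner_graph (A - {e})"
        by (auto simp: inner_graph_def)
      then show ?thesis
        using kostant_arc_recursion[of "inner_graph A" e "w - ?t"] e False
          increasing_multidigraphD(1)[OF increasing_inner_graph[OF A]]
          finite_kostant_flows[OF increasing_inner_graph[OF A]]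
        by (simp add: coeff_def)
    qed
    ultimately show ?thesis by simp
  qed
  then have "dir_shift m (direction e) (coeff A) = (\<lambda>w. coeff (A - {e}) (w - ?t))" by blast
  \<comment> \<open>The deletion leaves a translation by \<open>\<epsilon>\<^sub>j\<close>, j the
    head of e, and the in-degree weight drops by exactly that vector, so the result is again of the
    form \<open>mixed\<close>.\<close>
  moreover have "weight A = weight (A - {e}) + ?t"
    using A e by (simp add: weight_def admissible_def sum.remove)
  ultimately show ?thesis
    unfolding mixed_def foldr_Cons o_apply
    by (simp add: foldr_dir_shift_commute[symmetric] foldr_dir_shift_translate)
qed

lemma lookup_weight:
  assumes "admissible A" "k \<in> {1..m}"
  shows "Poly_Mapping.lookup (weight A) k = int (card {e\<in>A. tgt e = k}) - 1"
proof -
  have "(\<Sum>e\<in>A. if k = tgt e then 1 else 0 :: int) = int (card {e\<in>A. k = tgt e})"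
    using assms by (simp add: sum.If_cases admissible_def Int_def)
  moreover have "{e\<in>A. k = tgt e} = {e\<in>A. tgt e = k}" by auto
  ultimately show ?thesis
    using assms by (simp add: weight_def lookup_minus lookup_sum lookup_single when_def)
qed

lemma keys_weight:
  assumes "admissible A"
  shows "Poly_Mapping.keys (weight A) \<subseteq> {1..m}"
proof
  fix k assume "k \<in> Poly_Mapping.keys (weight A)"
  then have nz: "(\<Sum>e\<in>A. if tgt e = k then 1 else 0 :: int) - (\<Sum>l\<in>{1..m}. if l = k then 1 else 0) \<noteq> 0"
    by (simp only: in_keys_iff weight_def lookup_minus lookup_sum lookup_single when_def simp_thms)
  show "k \<in> {1..m}"
  proof (rule ccontr)
    assume "k \<notin> {1..m}"
    then have "(\<Sum>l\<in>{1..m}. if l = k then 1 else 0 :: int) = 0" by simp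
    moreover have "(\<Sum>e\<in>A. if tgt e = k then 1 else 0 :: int) = 0"
      using assms \<open>k \<notin> {1..m}\<close> by (intro sum.neutral) (force simp: admissible_def)
    ultimately show False using nz by simp
  qed
qed

lemma sum_weight:
  assumes "admissible A"
  shows "(\<Sum>k\<in>{1..m}. Poly_Mapping.lookup (weight A) k) = int (card A) - int m"
proof -
  have fin: "finite A" using assms by (simp add: admissible_def)
  have "A = (\<Union>k\<in>{1..m}. {e\<in>A. tgt e = k})"
    using assms by (force simp: admissible_def)
  then have "card A = card (\<Union>k\<in>{1..m}. {e\<in>A. tgt e = k})" by simp
  also have "\<dots> = (\<Sum>k\<in>{1..m}. card {e\<in>A. tgt e = k})"
    by (rule card_UN_disjoint) (use fin in auto)
  finally have "int (card A) = (\<Sum>k\<in>{1..m}. int (card {e\<in>A. tgt e = k}))" by simp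
  then show ?thesis
    using lookup_weight[OF assms] by (simp add: sum_subtractf)
qed

text \<open>If no arc enters k, every net flow is nonnegative at k, whereas the weight there is -1
  and shifts only lower it.\<close>

lemma mixed_not_covered:
  assumes A: "admissible A" and "\<not> covered A"
  shows "mixed A xs = 0"
proof -
  obtain k where k: "k \<in> {1..m}" and none: "{e\<in>A. tgt e = k} = {}"
    using assms(2) by (auto simp: covered_def)
  have "foldr (dir_shift m) xs (coeff A) w = 0" if "Poly_Mapping.lookup w k < 0" for w
    using that
  proof (induction xs arbitrary: w)
    case Nil
    have "net_flow (inner_graph A) f \<noteq> w" for f
    proof
      assume "net_flow (inner_graph A) f = w"
      moreover have "Poly_Mapping.lookup (net_flow (inner_graph A) f) k \<ge> 0"
        unfolding lookup_net_flow using none by (intro sum_nonneg) auto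
      ultimately show False using Nil by simp
    qed
    then show ?case
      using kostant_eq_0_iff[OF increasing_inner_graph[OF A], of w] by (simp add: coeff_def)
  next
    case (Cons x xs)
    have "foldr (dir_shift m) xs (coeff A) (w - Poly_Mapping.single i 1) = 0" for i
      using Cons.prems by (intro Cons.IH) (auto simp: lookup_minus lookup_single when_def)
    then show ?case
      unfolding foldr_Cons o_apply by (subst dir_shift_def) simp
  qed
  moreover have "Poly_Mapping.lookup (weight A) k < 0"
    using lookup_weight[OF A k] none by simp
  ultimately show ?thesis by (simp add: mixed_def)
qed

lemma mixed_nonneg:
  assumes "\<And>x k. x \<in> set xs \<Longrightarrow> k \<in> {1..m} \<Longrightarrow> x k \<ge> 0"
  shows "mixed A xs \<ge> 0"
  unfolding mixed_def by (rule foldr_dir_shift_nonneg) (use assms coeff_nonneg in auto)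

lemma card_tgt_pos:
  assumes "admissible A" "covered A" "k \<in> {1..m}"
  shows "card {e\<in>A. tgt e = k} \<ge> 1"
proof -
  have "{e\<in>A. tgt e = k} \<noteq> {}" "finite {e\<in>A. tgt e = k}"
    using assms by (auto simp: covered_def admissible_def)
  then show ?thesis by (simp add: Suc_le_eq card_gt_0_iff)
qed

lemma mixed_pos:
  assumes A: "admissible A" and cov: "covered A"
    and pos: "\<And>x k. x \<in> set xs \<Longrightarrow> k \<in> {1..m} \<Longrightarrow> x k > 0"
    and len: "length xs + m = card A"
  shows "mixed A xs > 0"
  unfolding mixed_def
proof (rule foldr_dir_shift_pos)
  show "coeff A 0 > 0"
    using kostant_0_pos[OF increasing_inner_graph[OF A]] by (simp add: coeff_def)
  show "Poly_Mapping.lookup (weight A) k \<ge> 0" for k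
  proof (cases "k \<in> {1..m}")
    case True
    then show ?thesis using lookup_weight[OF A True] card_tgt_pos[OF A cov True] by simp
  next
    case False
    then have "Poly_Mapping.lookup (weight A) k = 0"
      using keys_weight[OF A] by (meson in_keys_iff subsetD)
    then show ?thesis by simp
  qed
  show "(\<Sum>k\<in>{1..m}. Poly_Mapping.lookup (weight A) k) = int (length xs)"
    using sum_weight[OF A] len by simp
qed (use pos coeff_nonneg keys_weight[OF A] in auto)

text \<open>The coefficients form a flow with supply \<open>a\<close> towards the root 0: from the top vertex
  down, the total amount at a vertex is split evenly among the arcs entering it.\<close>

lemma positive_combination:
  assumes A: "admissible A" and cov: "covered A" and a: "\<And>k. k \<in> {1..m} \<Longrightarrow> a k > 0"
  obtains t where "\<And>e. e \<in> A \<Longrightarrow> t e > 0"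
    and "\<And>k. k \<in> {1..m} \<Longrightarrow> a k = (\<Sum>e\<in>A. t e * direction e k)"
proof -
  have fin: "finite A" using A by (simp add: admissible_def)
  define r where "r k = real (card {e\<in>A. tgt e = k})" for k
  have r: "r k > 0" if "k \<in> {1..m}" for k
    using card_tgt_pos[OF A cov that] by (simp add: r_def)
  define through where "through T k \<longleftrightarrow> T k > 0 \<and>
    T k = a k + (\<Sum>e\<in>{e\<in>A. src e = k}. T (tgt e) / r (tgt e))" for T :: "nat \<Rightarrow> real" and k
  have "\<exists>T. \<forall>k\<in>{m - n<..m}. k \<ge> 1 \<longrightarrow> through T k" for n
  proof (induction n)
    case 0
    then show ?case by simp
  next
    case (Suc n)
    then obtain T where T: "\<And>k. k \<in> {m - n<..m} \<Longrightarrow> k \<ge> 1 \<Longrightarrow> through T k" by blast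
    define l where "l = m - n"
    define T' where "T' = T(l := a l + (\<Sum>e\<in>{e\<in>A. src e = l}. T (tgt e) / r (tgt e)))"
    \<comment> \<open>Arcs leaving a vertex \<open>k \<ge> l\<close> end strictly above l, so
      redefining T at l changes none of these sums.\<close>
    have sums: "(\<Sum>e\<in>{e\<in>A. src e = k}. T' (tgt e) / r (tgt e)) = (\<Sum>e\<in>{e\<in>A. src e = k}. T (tgt e) / r (tgt e))"
      if "k \<ge> l" for k
      by (intro sum.cong refl) (use A that in \<open>auto simp: T'_def admissible_def\<close>)
    have "through T' k" if "k \<in> {m - Suc n<..m}" "k \<ge> 1" for k
    proof (cases "k = l")
      case False
      then have "k \<in> {m - n<..m}" using that by (auto simp: l_def)
      then show ?thesis
        using T[of k] that False sums[of k] by (simp add: through_def l_def T'_def)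
    next
      case True
      have "T (tgt e) / r (tgt e) \<ge> 0" if e: "e \<in> A" "src e = l" for e
      proof -
        have "tgt e \<in> {m - n<..m}" "tgt e \<in> {1..m}"
          using A e by (auto simp: admissible_def l_def)
        then show ?thesis
          using T[of "tgt e"] r[of "tgt e"] by (simp add: through_def less_imp_le)
      qed
      then have "(\<Sum>e\<in>{e\<in>A. src e = l}. T (tgt e) / r (tgt e)) \<ge> 0" by (intro sum_nonneg) auto
      moreover have "a l > 0" using a that True by simp
      ultimately show ?thesis
        using True sums[of l] by (simp add: through_def T'_def)
    qed
    then show ?case by blast
  qed
  then obtain T where "\<forall>k\<in>{m - m<..m}. k \<ge> 1 \<longrightarrow> through T k" by blast
  then have T: "through T k" if "k \<in> {1..m}" for k using that by simp
  define t where "t e = T (tgt e) / r (tgt e)" for e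
  show thesis
  proof (rule that[of t])
    show "t e > 0" if "e \<in> A" for e
    proof -
      have "tgt e \<in> {1..m}" using A that by (force simp: admissible_def)
      then have "T (tgt e) > 0" "r (tgt e) > 0" using T r unfolding through_def by blast+
      then show ?thesis by (simp add: t_def)
    qed
    fix k assume k: "k \<in> {1..m}"
    have "(\<Sum>e\<in>A. t e * direction e k)
        = (\<Sum>e\<in>A. if tgt e = k then t e else 0) - (\<Sum>e\<in>A. if src e = k then t e else 0)"
      unfolding sum_subtractf[symmetric] by (intro sum.cong refl) (auto simp: direction_def)
    also have "(\<Sum>e\<in>A. if tgt e = k then t e else 0) = (\<Sum>e\<in>{e\<in>A. tgt e = k}. t e)"
      using fin by (simp add: sum.inter_filter)
    also have "\<dots> = (\<Sum>e\<in>{e\<in>A. tgt e = k}. T k / r k)"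
      by (intro sum.cong refl) (simp add: t_def)
    also have "\<dots> = T k" using r[OF k] by (simp add: r_def)
    also have "(\<Sum>e\<in>A. if src e = k then t e else 0) = (\<Sum>e\<in>{e\<in>A. src e = k}. t e)"
      using fin by (simp add: sum.inter_filter)
    finally show "a k = (\<Sum>e\<in>A. t e * direction e k)"
      using T[OF k] by (simp add: through_def t_def)
  qed
qed

text \<open>Any x is the difference of two positive vectors: x raised by a large constant b, and the
  constant b itself.\<close>

lemma combination:
  assumes A: "admissible A" and cov: "covered A"
  obtains s where "\<And>k. k \<in> {1..m} \<Longrightarrow> x k = (\<Sum>e\<in>A. s e * direction e k)"
proof -
  define b where "b = 1 + (\<Sum>k\<in>{1..m}. \<bar>x k\<bar>)"
  have "b + x k > 0" if "k \<in> {1..m}" for k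
    using member_le_sum[of k "{1..m}" "\<lambda>k. \<bar>x k\<bar>"] that by (simp add: b_def)
  then obtain s where s: "\<And>k. k \<in> {1..m} \<Longrightarrow> b + x k = (\<Sum>e\<in>A. s e * direction e k)"
    using positive_combination[OF A cov, of "\<lambda>k. b + x k"] by blast
  have "b > 0" unfolding b_def by (intro add_pos_nonneg sum_nonneg) auto
  then obtain s' where s': "\<And>k. k \<in> {1..m} \<Longrightarrow> b = (\<Sum>e\<in>A. s' e * direction e k)"
    using positive_combination[OF A cov, of "\<lambda>k. b"] by blast
  show thesis
  proof (rule that[of "\<lambda>e. s e - s' e"])
    fix k assume k: "k \<in> {1..m}"
    show "x k = (\<Sum>e\<in>A. (s e - s' e) * direction e k)"
      unfolding left_diff_distrib sum_subtractf using s[OF k] s'[OF k] by simp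
  qed
qed

lemma mixed_swap_tail: "mixed A (z # x # y # xs) = mixed A (z # y # x # xs)"
  by (simp add: mixed_def dir_shift_commute)

lemma mixed_units: "mixed A (x # xs) = (\<Sum>k\<in>{1..m}. x k * mixed A ((\<lambda>i. of_bool (i = k)) # xs))"
  unfolding mixed_def foldr_Cons o_apply by (rule dir_shift_units)

lemma hyperbolic_mixed_not_covered:
  assumes "admissible A" "\<not> covered A"
  shows "hyperbolic (\<lambda>x y. mixed A (x # y # xs))"
  using mixed_not_covered[OF assms] by (simp add: hyperbolic_def)

text \<open>A vertex entered by a single arc contributes a vector of the kernel, so at most two
  coordinate vectors remain, and the lower one is isotropic since nothing can flow upwards.\<close>

lemma hyperbolic_mixed_quadratic:
  assumes A: "admissible A" and card: "card A = m + 2"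
  shows "hyperbolic (\<lambda>x y. mixed A [x, y])"
proof (cases "covered A")
  case False
  then show ?thesis by (rule hyperbolic_mixed_not_covered[OF A])
next
  case cov: True
  define f where "f k = card {e\<in>A. tgt e = k} - 1" for k
  define u where "u k = (\<lambda>i. of_bool (i = k) :: real)" for k :: nat
  have f: "int (f k) = Poly_Mapping.lookup (weight A) k" if "k \<in> {1..m}" for k
    using lookup_weight[OF A that] card_tgt_pos[OF A cov that] by (simp add: f_def)
  have "int (\<Sum>k\<in>{1..m}. f k) = 2"
    using sum_weight[OF A] card by (simp add: f)
  then have "(\<Sum>k\<in>{1..m}. f k) = 2" by linarith
  from two_positive_positions[OF finite_atLeastAtMost this]
  obtain i j where i: "i \<in> {1..m}" and j: "j \<in> {1..m}" and ij: "i \<le> j" and fj: "f j > 0"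
    and f0: "\<And>k. k \<in> {1..m} \<Longrightarrow> k \<noteq> i \<Longrightarrow> k \<noteq> j \<Longrightarrow> f k = 0" by blast
  have units: "\<exists>X Y. \<forall>y. mixed A [u k, y] = X * mixed A [u i, y] + Y * mixed A [u j, y]"
    if "k \<in> {1..m}" for k
    using that
  proof (induction k rule: less_induct)
    case (less k)
    consider "k = i" | "k = j" | "k \<noteq> i" "k \<noteq> j" by blast
    then show ?case
    proof cases
      case 1
      then show ?thesis by (intro exI[of _ 1] exI[of _ 0]) simp
    next
      case 2
      then show ?thesis by (intro exI[of _ 0] exI[of _ 1]) simp
    next
      case 3
      obtain e where e: "e \<in> A" "tgt e = k"
        using cov less.prems unfolding covered_def by blast
      have fin: "finite {e\<in>A. tgt e = k}" using A by (simp add: admissible_def)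
      have "card {e\<in>A. tgt e = k} = 1"
        using f0[OF less.prems 3] card_tgt_pos[OF A cov less.prems] by (simp add: f_def)
      then obtain x where "{e\<in>A. tgt e = k} = {x}" by (rule card_1_singletonE)
      moreover have "e \<in> {e\<in>A. tgt e = k}" using e by simp
      ultimately have "{e\<in>A. tgt e = k} = {e}" by simp
      then have "\<not> covered (A - {e})"
        using less.prems by (auto simp: covered_def)
      then have "mixed A [direction e, y] = 0" for y
        using mixed_direction[OF A e(1)] mixed_not_covered[OF admissible_remove[OF A]] by simp
      moreover have "mixed A [direction e, y] = mixed A [u k, y] - mixed A [u (src e), y]" for y
        using mixed_diff[of A 1 "u k" 1 "u (src e)" "[y]"] e(2)
        by (simp add: direction_def[abs_def] u_def)
      ultimately have eq: "mixed A [u k, y] = mixed A [u (src e), y]" for y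
        by (metis eq_iff_diff_eq_0)
      show ?thesis
      proof (cases "src e = 0")
        case True
        have "mixed A [u (src e), y] = 0" for y
          by (subst mixed_units) (auto simp: True u_def intro!: sum.neutral)
        then show ?thesis unfolding eq by (intro exI[of _ 0]) simp
      next
        case False
        then show ?thesis
          unfolding eq using A e less.prems by (intro less.IH) (auto simp: admissible_def)
      qed
    qed
  qed
  then obtain X Y where XY: "\<And>k y. k \<in> {1..m} \<Longrightarrow>
      mixed A [u k, y] = X k * mixed A [u i, y] + Y k * mixed A [u j, y]"
    by metis
  show ?thesis
  proof (rule hyperbolic_if_rank_two[where e = "u i" and f = "u j"])
    show "mixed A [x, y] = mixed A [y, x]" for x y by (rule mixed_swap)
    show "\<exists>X Y. \<forall>y. mixed A [x, y] = X * mixed A [u i, y] + Y * mixed A [u j, y]" for x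
    proof (intro exI allI)
      fix y
      have "mixed A [x, y] = (\<Sum>k\<in>{1..m}. x k * mixed A [u k, y])"
        unfolding u_def by (rule mixed_units)
      also have "\<dots> = (\<Sum>k\<in>{1..m}. x k * X k) * mixed A [u i, y]
          + (\<Sum>k\<in>{1..m}. x k * Y k) * mixed A [u j, y]"
        unfolding sum_distrib_right sum.distrib[symmetric]
        by (intro sum.cong refl) (simp only: XY distrib_left mult.assoc)
      finally show "mixed A [x, y] = (\<Sum>k\<in>{1..m}. x k * X k) * mixed A [u i, y]
          + (\<Sum>k\<in>{1..m}. x k * Y k) * mixed A [u j, y]" .
    qed
    show "mixed A [u i, u i] * mixed A [u j, u j] \<le> (mixed A [u i, u j])\<^sup>2"
    proof (cases "i = j")
      case True
      then show ?thesis by (simp add: power2_eq_square)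
    next
      case False
      with ij have "i < j" by simp
      \<comment> \<open>Both units are taken at the lower vertex i, so the part above i still has
        total at least \<open>f j > 0\<close>, while the cut formula bounds every net flow there by
        0.\<close>
      let ?w = "weight A - Poly_Mapping.single i 1 - Poly_Mapping.single i 1"
      have "net_flow (inner_graph A) g \<noteq> ?w" for g
      proof
        assume g: "net_flow (inner_graph A) g = ?w"
        have "(\<Sum>k\<in>{i<..m}. Poly_Mapping.lookup (net_flow (inner_graph A) g) k) \<le> 0"
          unfolding sum_net_flow_upper[OF increasing_inner_graph[OF A]]
          by (simp add: sum_nonneg)
        moreover have "(\<Sum>k\<in>{i<..m}. Poly_Mapping.lookup ?w k) = (\<Sum>k\<in>{i<..m}. int (f k))"
        proof (intro sum.cong refl)
          fix k assume k: "k \<in> {i<..m}"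
          then have "Poly_Mapping.lookup (Poly_Mapping.single i 1) k = (0 :: int)"
            by (simp add: lookup_single)
          moreover have "int (f k) = Poly_Mapping.lookup (weight A) k"
            using k i by (intro f) simp
          ultimately show "Poly_Mapping.lookup ?w k = int (f k)"
            by (simp only: lookup_minus diff_zero)
        qed
        moreover have "(\<Sum>k\<in>{i<..m}. int (f k)) \<ge> int (f j)"
          using j \<open>i < j\<close> by (intro member_le_sum) auto
        ultimately show False using g fj by simp
      qed
      then have "coeff A ?w = 0"
        using kostant_eq_0_iff[OF increasing_inner_graph[OF A], of ?w] by (simp add: coeff_def)
      then have "mixed A [u i, u i] = 0"
        using i by (simp add: mixed_def u_def dir_shift_unit)
      then show ?thesis by simp
    qed
  qed
qed

text \<open>The head \<open>a\<close> of the list has a double role: it fills a slot of the form B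
  and is the vector whose complement is tested. Strictly positive entries make both
  \<open>B (direction e) a\<close> and the pairings of jointly removable arcs positive, which the
  spectral gap requires; zero entries are reached later by a limit.\<close>

lemma hyperbolic_mixed:
  assumes "admissible A" and "length xs + 2 + m = card A"
    and "\<And>x k. x \<in> set xs \<Longrightarrow> k \<in> {1..m} \<Longrightarrow> x k > 0"
  shows "hyperbolic (\<lambda>x y. mixed A (x # y # xs))"
  using assms
proof (induction xs arbitrary: A)
  case Nil
  then show ?case using hyperbolic_mixed_quadratic by simp
next
  case (Cons a xs)
  note A = Cons.prems(1) and len = Cons.prems(2) and pos = Cons.prems(3)
  have fin: "finite A" using A by (simp add: admissible_def)
  show ?case
  proof (cases "covered A")
    case False
    then show ?thesis by (rule hyperbolic_mixed_not_covered[OF A])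
  next
    case cov: True
    \<comment> \<open>An arc outside I is the only one entering its head, so its direction lies in
      the radical of B; the frame consists of the removable arcs.\<close>
    define I where "I = {e\<in>A. covered (A - {e})}"
    define B where "B x y = mixed A (x # y # a # xs)" for x y
    have I: "e \<in> A" "covered (A - {e})" if "e \<in> I" for e
      using that by (auto simp: I_def)
    have B_dir: "B (direction e) y = mixed (A - {e}) (y # a # xs)" if "e \<in> A" for e y
      using mixed_direction[OF A that] by (simp add: B_def)
    have B_dir0: "B (direction e) y = 0" if "e \<in> A" "e \<notin> I" for e y
      using that B_dir mixed_not_covered[OF admissible_remove[OF A]] by (simp add: I_def)
    have B_sum: "B x y = (\<Sum>e\<in>I. s e * B (direction e) y)"
      if x: "\<And>k. k \<in> {1..m} \<Longrightarrow> x k = (\<Sum>e\<in>A. s e * direction e k)" for x y s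
    proof -
      have "B x y = (\<Sum>e\<in>A. s e * B (direction e) y)"
        unfolding B_def mixed_sum[symmetric] by (rule mixed_cong) (rule x)
      also have "\<dots> = (\<Sum>e\<in>I. s e * B (direction e) y)"
        using fin B_dir0 by (intro sum.mono_neutral_right) (auto simp: I_def)
      finally show ?thesis .
    qed
    obtain t where t: "\<And>e. e \<in> A \<Longrightarrow> t e > 0"
      and a: "\<And>k. k \<in> {1..m} \<Longrightarrow> a k = (\<Sum>e\<in>A. t e * direction e k)"
      using positive_combination[OF A cov, of a] pos by auto
    have card1: "card (A - {e}) = card A - 1" if "e \<in> A" for e
      using fin that by simp
    have B_dir_a: "B (direction e) a > 0" if e: "e \<in> I" for e
      unfolding B_dir[OF I(1)[OF e]]
      by (rule mixed_pos[OF admissible_remove[OF A] I(2)[OF e]])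
        (use pos len card1[OF I(1)[OF e]] in auto)
    have B_dir2: "B (direction e) (direction e') = mixed (A - {e} - {e'}) (a # xs)"
      if "e \<in> A" "e' \<in> A" "e \<noteq> e'" for e e'
      using B_dir[OF that(1)] mixed_direction[OF admissible_remove[OF A], of e' "{e}" "a # xs"] that by simp
    have B_dir2_pos: "B (direction e) (direction e') > 0"
      if "e \<in> A" "e' \<in> A" "e \<noteq> e'" "covered (A - {e} - {e'})" for e e'
      unfolding B_dir2[OF that(1-3)]
      by (rule mixed_pos[OF admissible_remove[OF admissible_remove[OF A]] that(4)])
        (use pos len fin that in \<open>auto simp: card_Diff_singleton\<close>)
    \<comment> \<open>When the heads differ, each vertex loses at most one of the two arcs, and each
      single deletion leaves every vertex covered.\<close>
    have diff_tgt: "B (direction e) (direction e') > 0"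
      if e: "e \<in> I" "e' \<in> I" and ne: "tgt e \<noteq> tgt e'" for e e'
    proof (rule B_dir2_pos)
      show "covered (A - {e} - {e'})"
        unfolding covered_def
      proof
        fix k assume k: "k \<in> {1..m}"
        obtain e1 e2 where "e1 \<in> A - {e}" "tgt e1 = k" "e2 \<in> A - {e'}" "tgt e2 = k"
          using I(2)[OF e(1)] I(2)[OF e(2)] k unfolding covered_def by blast
        then show "\<exists>e''\<in>A - {e} - {e'}. tgt e'' = k"
          using ne by (cases "e1 = e'") auto
      qed
    qed (use e ne I in auto)
    have conn: "B (direction e) (direction e') > 0 \<or>
        (\<exists>k\<in>I. k \<noteq> e \<and> k \<noteq> e' \<and> B (direction e) (direction k) > 0 \<and> B (direction k) (direction e') > 0)"
      if e: "e \<in> I" "e' \<in> I" and ne: "e \<noteq> e'" for e e'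
    proof (cases "\<exists>k\<in>I. tgt k \<noteq> tgt e")
      case True
      then obtain k where k: "k \<in> I" "tgt k \<noteq> tgt e" by blast
      show ?thesis
      proof (cases "tgt e' = tgt e")
        case True
        then show ?thesis using k diff_tgt e by metis
      next
        case False
        then show ?thesis using diff_tgt e by metis
      qed
    next
      case False
      then have same: "\<And>k. k \<in> I \<Longrightarrow> tgt k = tgt e" by blast
      have et: "tgt e \<in> {1..m}" using A I(1)[OF e(1)] by (force simp: admissible_def)
      \<comment> \<open>All removable arcs now enter one vertex, so any other vertex has at most one
        entering arc and R has at most \<open>m - 1\<close> elements. As A has at least
        \<open>m + 3\<close>, a third arc enters \<open>tgt e\<close>, and both e and e' can be
        deleted together.\<close>
      define R where "R = {k\<in>A. tgt k \<noteq> tgt e}"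
      have "inj_on tgt R"
      proof (rule inj_onI, rule ccontr)
        fix k l assume kl: "k \<in> R" "l \<in> R" "tgt k = tgt l" "k \<noteq> l"
        have "covered (A - {k})"
          unfolding covered_def
        proof
          fix q assume "q \<in> {1..m}"
          then obtain p where "p \<in> A" "tgt p = q" using cov unfolding covered_def by blast
          then show "\<exists>p\<in>A - {k}. tgt p = q"
            using kl by (cases "p = k") (auto simp: R_def)
        qed
        then have "k \<in> I" using kl by (simp add: I_def R_def)
        then show False using same kl by (simp add: R_def)
      qed
      then have "card R = card (tgt ` R)" by (simp add: card_image)
      also have "\<dots> \<le> card ({1..m} - {tgt e})"
        using A by (intro card_mono) (force simp: R_def admissible_def)+
      also have "\<dots> = m - 1" using et by simp
      finally have cR: "card R \<le> m - 1" .
      have "A \<noteq> R \<union> {e, e'}"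
      proof
        assume "A = R \<union> {e, e'}"
        then have "card A \<le> card R + card {e, e'}" by (metis card_Un_le)
        then show False using cR len ne by simp
      qed
      then obtain e'' where e'': "e'' \<in> A" "e'' \<noteq> e" "e'' \<noteq> e'" "tgt e'' = tgt e"
        using I(1)[OF e(1)] I(1)[OF e(2)] by (auto simp: R_def)
      have "covered (A - {e} - {e'})"
        unfolding covered_def
      proof
        fix q assume "q \<in> {1..m}"
        then obtain p where "p \<in> A" "tgt p = q" using cov unfolding covered_def by blast
        then show "\<exists>p\<in>A - {e} - {e'}. tgt p = q"
          using e'' same[OF e(2)] by (cases "p = e \<or> p = e'") auto
      qed
      then show ?thesis using B_dir2_pos I(1) e ne by blast
    qed
    have "hyperbolic B"
    proof (rule hyperbolic_if_frame[where I = I and d = direction and t = t and a = a])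
      show "finite I" using fin by (simp add: I_def)
      show sym: "B x y = B y x" for x y
        unfolding B_def by (rule mixed_swap)
      show "\<exists>z. \<forall>u. B z u = \<alpha> * B x u - \<beta> * B y u" for \<alpha> \<beta> x y
        unfolding B_def using mixed_diff by blast
      show "\<exists>x. \<forall>u. B x u = (\<Sum>e\<in>I. s e * B (direction e) u)" for s
        unfolding B_def using mixed_sum by blast
      show "\<exists>s. \<forall>u. B x u = (\<Sum>e\<in>I. s e * B (direction e) u)" for x
      proof -
        obtain s where "\<And>k. k \<in> {1..m} \<Longrightarrow> x k = (\<Sum>e\<in>A. s e * direction e k)"
          using combination[OF A cov] by blast
        then have "\<forall>u. B x u = (\<Sum>e\<in>I. s e * B (direction e) u)" using B_sum by blast
        then show ?thesis by blast
      qed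
      show "t e > 0" if "e \<in> I" for e using t I(1)[OF that] by blast
      show "B a u = (\<Sum>e\<in>I. t e * B (direction e) u)" for u
        by (rule B_sum) (rule a)
      show "B (direction e) a > 0" if "e \<in> I" for e using B_dir_a[OF that] .
      show "B (direction e) (direction e') \<ge> 0" if "e \<in> I" "e' \<in> I" "e \<noteq> e'" for e e'
        unfolding B_dir2[OF I(1)[OF that(1)] I(1)[OF that(2)] that(3)]
        by (rule mixed_nonneg) (use pos in \<open>auto intro: less_imp_le\<close>)
      show "B x x \<le> (\<Sum>e\<in>I. t e * (B (direction e) x)\<^sup>2 / B (direction e) a)" for x
      proof -
        \<comment> \<open>The Bochner step: the fixed entry \<open>a\<close> is moved to the front
          and expanded into directions, giving a positive combination of forms of smaller arc sets.
          The induction hypothesis compares x with \<open>a\<close> in each of them, and the values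
          at (x, a) and (a, a) are pairings of B with \<open>direction e\<close>.\<close>
        have "B x x = mixed A (a # x # x # xs)"
          unfolding B_def by (metis mixed_swap mixed_swap_tail)
        also have "\<dots> = (\<Sum>e\<in>A. t e * mixed (A - {e}) (x # x # xs))"
        proof -
          have "mixed A (a # x # x # xs) = mixed A ((\<lambda>k. \<Sum>e\<in>A. t e * direction e k) # x # x # xs)"
            by (rule mixed_cong) (rule a)
          then show ?thesis unfolding mixed_sum by (simp add: mixed_direction[OF A])
        qed
        also have "\<dots> = (\<Sum>e\<in>I. t e * mixed (A - {e}) (x # x # xs))"
          using fin mixed_not_covered[OF admissible_remove[OF A]]
          by (intro sum.mono_neutral_right) (auto simp: I_def)
        also have "\<dots> \<le> (\<Sum>e\<in>I. t e * (B (direction e) x)\<^sup>2 / B (direction e) a)"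
        proof (rule sum_mono)
          fix e assume e: "e \<in> I"
          let ?H = "\<lambda>x y. mixed (A - {e}) (x # y # xs)"
          have "hyperbolic ?H"
            by (rule Cons.IH) (use A pos len card1[OF I(1)[OF e]] in \<open>auto intro: admissible_remove\<close>)
          then have "?H x x * ?H a a \<le> (?H x a)\<^sup>2"
            using B_dir_a[OF e] by (simp add: hyperbolic_def B_dir[OF I(1)[OF e]])
          then have "mixed (A - {e}) (x # x # xs) * B (direction e) a \<le> (B (direction e) x)\<^sup>2"
            by (simp add: B_dir[OF I(1)[OF e]])
          then have "mixed (A - {e}) (x # x # xs) \<le> (B (direction e) x)\<^sup>2 / B (direction e) a"
            using B_dir_a[OF e] by (simp add: pos_le_divide_eq)
          then show "t e * mixed (A - {e}) (x # x # xs) \<le> t e * (B (direction e) x)\<^sup>2 / B (direction e) a"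
            using t[OF I(1)[OF e]] by (simp only: mult_left_mono less_imp_le times_divide_eq_right[symmetric])
        qed
        finally show ?thesis .
      qed
    qed (rule conn)
    then show ?thesis by (simp add: B_def[abs_def])
  qed
qed

text \<open>Raise every entry by \<open>\<eta> > 0\<close> and let it tend to 0. The premise at y is
  an open condition, so it holds for small \<open>\<eta>\<close>, and the inequality passes to the
  limit.\<close>

lemma hyperbolic_mixed_nonneg:
  assumes A: "admissible A" and len: "length xs + 2 + m = card A"
    and nonneg: "\<And>x k. x \<in> set xs \<Longrightarrow> k \<in> {1..m} \<Longrightarrow> x k \<ge> 0"
  shows "hyperbolic (\<lambda>x y. mixed A (x # y # xs))"
  unfolding hyperbolic_def
proof (intro allI impI)
  fix x y assume pos: "mixed A (y # y # xs) > 0"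
  define P where "P \<eta> = map (\<lambda>x k. x k + \<eta>) xs" for \<eta> :: real
  have "((\<lambda>\<eta>. foldr (dir_shift m) (map (\<lambda>x k. x k + \<eta>) ys) (coeff A) w)
      \<longlongrightarrow> foldr (dir_shift m) ys (coeff A) w) (at_right 0)" for ys w
  proof (induction ys arbitrary: w)
    case (Cons z ys)
    have "((\<lambda>\<eta>. z k + \<eta>) \<longlongrightarrow> z k) (at_right 0)" for k
      by (rule tendsto_eq_intros | simp)+
    with Cons show ?case
      unfolding list.map foldr_Cons o_apply by (intro tendsto_dir_shift)
  qed simp
  then have lim: "((\<lambda>\<eta>. mixed A (x # y # P \<eta>)) \<longlongrightarrow> mixed A (x # y # xs)) (at_right 0)" for x y
    unfolding mixed_def foldr_Cons o_apply P_def by (intro tendsto_dir_shift tendsto_const)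
  have "\<forall>\<^sub>F \<eta> in at_right 0. 0 < mixed A (y # y # P \<eta>)"
    by (rule order_tendstoD(1)[OF lim pos])
  moreover have "\<forall>\<^sub>F \<eta> :: real in at_right 0. \<eta> > 0"
    by (rule eventually_at_right_less)
  ultimately have "\<forall>\<^sub>F \<eta> in at_right 0. mixed A (x # x # P \<eta>) * mixed A (y # y # P \<eta>)
      \<le> (mixed A (x # y # P \<eta>))\<^sup>2"
  proof eventually_elim
    case (elim \<eta>)
    have "hyperbolic (\<lambda>x y. mixed A (x # y # P \<eta>))"
      by (rule hyperbolic_mixed[OF A])
        (use len nonneg elim in \<open>auto simp: P_def intro: add_nonneg_pos\<close>)
    then show ?case using elim by (simp add: hyperbolic_def)
  qed
  then show "mixed A (x # x # xs) * mixed A (y # y # xs) \<le> (mixed A (x # y # xs))\<^sup>2"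
    by (intro tendsto_le[OF _ tendsto_power[OF lim] tendsto_mult[OF lim lim]]) auto
qed

end

section \<open>Lorentzian polynomials and log-concavity\<close>

text \<open>Walk along a residual path: change f by one unit towards g on an arc at i, which moves
  the defect to the other end k; stop if f has a surplus at k, otherwise continue from k. The two
  truncated differences add up to the distance of f and g on an arc, and the total distance
  drops.\<close>

lemma net_flow_exchange:
  assumes fin: "finite (arcs G)" and loopfree: "\<And>e. e \<in> arcs G \<Longrightarrow> tail G e \<noteq> head G e"
    and "Poly_Mapping.lookup (net_flow G f) i < Poly_Mapping.lookup (net_flow G g) i"
  shows "\<exists>j f'. Poly_Mapping.lookup (net_flow G g) j < Poly_Mapping.lookup (net_flow G f) j \<and>
    net_flow G f' = net_flow G f + Poly_Mapping.single i 1 - Poly_Mapping.single j 1"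
  using assms(3)
proof (induction "\<Sum>e\<in>arcs G. (g e - f e) + (f e - g e)" arbitrary: f i rule: less_induct)
  case less
  have "\<exists>e\<in>arcs G. tail G e = i \<and> f e < g e \<or> head G e = i \<and> g e < f e"
  proof (rule ccontr)
    assume no: "\<not> ?thesis"
    have "Poly_Mapping.lookup (net_flow G g) i \<le> Poly_Mapping.lookup (net_flow G f) i"
      unfolding lookup_net_flow
    proof (rule sum_mono)
      fix e assume "e \<in> arcs G"
      then show "(if tail G e = i then int (g e) else 0) - (if head G e = i then int (g e) else 0)
        \<le> (if tail G e = i then int (f e) else 0) - (if head G e = i then int (f e) else 0)"
        using no loopfree[of e] by (auto simp: not_less)
    qed
    then show False using less.prems by simp
  qed
  then obtain e k f1 where e: "e \<in> arcs G" and k: "k \<noteq> i"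
    and f1: "net_flow G f1 = net_flow G f + Poly_Mapping.single i 1 - Poly_Mapping.single k 1"
    and f1_e: "(g e - f1 e) + (f1 e - g e) < (g e - f e) + (f e - g e)"
    and f1_other: "\<And>e'. e' \<noteq> e \<Longrightarrow> f1 e' = f e'"
  proof
    fix e assume e: "e \<in> arcs G" and "tail G e = i \<and> f e < g e \<or> head G e = i \<and> g e < f e"
    then consider "tail G e = i" "f e < g e" | "head G e = i" "g e < f e" by blast
    then show thesis
    proof cases
      case 1
      show thesis
        by (rule that[OF e, of "head G e" "f(e := f e + 1)"])
          (use 1 loopfree[OF e] in \<open>auto simp: net_flow_upd[OF fin e]\<close>)
    next
      case 2
      have "int (f e - 1) - int (f e) = - 1" using 2 by auto
      then show thesis
        by (intro that[OF e, of "tail G e" "f(e := f e - 1)"])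
          (use 2 loopfree[OF e] in \<open>auto simp: net_flow_upd[OF fin e] single_uminus\<close>)
    qed
  qed
  have lookup_f1: "Poly_Mapping.lookup (net_flow G f1) j
    = Poly_Mapping.lookup (net_flow G f) j + (if j = i then 1 else 0) - (if j = k then 1 else 0)" for j
    by (simp add: f1 lookup_add lookup_minus lookup_single when_def)
  show ?case
  proof (cases "Poly_Mapping.lookup (net_flow G g) k < Poly_Mapping.lookup (net_flow G f) k")
    case True
    then show ?thesis using f1 by blast
  next
    case False
    have "(\<Sum>e\<in>arcs G. (g e - f1 e) + (f1 e - g e)) < (\<Sum>e\<in>arcs G. (g e - f e) + (f e - g e))"
    proof (rule sum_strict_mono_ex1[OF fin])
      show "\<forall>e'\<in>arcs G. (g e' - f1 e') + (f1 e' - g e') \<le> (g e' - f e') + (f e' - g e')"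
        using f1_e f1_other by (metis order_refl less_imp_le)
      show "\<exists>e'\<in>arcs G. (g e' - f1 e') + (f1 e' - g e') < (g e' - f e') + (f e' - g e')"
        using e f1_e by blast
    qed
    moreover have "Poly_Mapping.lookup (net_flow G f1) k < Poly_Mapping.lookup (net_flow G g) k"
      using False k by (simp add: lookup_f1)
    ultimately obtain j f' where j: "Poly_Mapping.lookup (net_flow G g) j < Poly_Mapping.lookup (net_flow G f1) j"
      and f': "net_flow G f' = net_flow G f1 + Poly_Mapping.single k 1 - Poly_Mapping.single j 1"
      using less.hyps by blast
    have "net_flow G f' = net_flow G f + Poly_Mapping.single i 1 - Poly_Mapping.single j 1"
      by (simp add: f' f1)
    \<comment> \<open>The walk cannot end at i, since the step raised i only up to at most the value
      for g; elsewhere \<open>f1\<close> never exceeds f.\<close>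
    moreover have "Poly_Mapping.lookup (net_flow G g) j < Poly_Mapping.lookup (net_flow G f) j"
      using j less.prems k by (auto simp: lookup_f1 split: if_splits)
    ultimately show ?thesis by blast
  qed
qed

lemma nonneg_vector_as_list:
  fixes v :: "nat \<Rightarrow>\<^sub>0 int"
  assumes "\<And>k. Poly_Mapping.lookup v k \<ge> 0" and "Poly_Mapping.keys v \<subseteq> S" and fin: "finite S"
  obtains ks where "set ks \<subseteq> S" "sum_list (map (\<lambda>k. Poly_Mapping.single k 1) ks) = v"
    "int (length ks) = (\<Sum>k\<in>S. Poly_Mapping.lookup v k)"
proof -
  have "\<exists>ks. set ks \<subseteq> S \<and> sum_list (map (\<lambda>k. Poly_Mapping.single k 1) ks) = v \<and>
      int (length ks) = (\<Sum>k\<in>S. Poly_Mapping.lookup v k)"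
    using assms(1,2)
  proof (induction "nat (\<Sum>k\<in>S. Poly_Mapping.lookup v k)" arbitrary: v)
    case 0
    have "(\<Sum>k\<in>S. Poly_Mapping.lookup v k) \<ge> 0" using 0 by (intro sum_nonneg) auto
    then have "(\<Sum>k\<in>S. Poly_Mapping.lookup v k) = 0" using 0 by simp
    then have "\<forall>k\<in>S. Poly_Mapping.lookup v k = 0"
      using 0 by (subst (asm) sum_nonneg_eq_0_iff[OF fin]) auto
    then have "Poly_Mapping.lookup v k = 0" for k
      using 0 by (meson in_keys_iff subsetD)
    then have "v = 0" by (intro poly_mapping_eqI) simp
    then show ?case by (intro exI[of _ "[]"]) simp
  next
    case (Suc n)
    have "\<exists>i\<in>S. Poly_Mapping.lookup v i > 0"
    proof (rule ccontr)
      assume "\<not> ?thesis"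
      then have "(\<Sum>k\<in>S. Poly_Mapping.lookup v k) \<le> 0" by (intro sum_nonpos) (auto simp: not_less)
      then show False using Suc.hyps by simp
    qed
    then obtain i where i: "i \<in> S" "Poly_Mapping.lookup v i > 0" by blast
    let ?v = "v - Poly_Mapping.single i 1"
    have lk: "Poly_Mapping.lookup ?v k = Poly_Mapping.lookup v k - (if k = i then 1 else 0)" for k
      by (simp add: lookup_minus lookup_single)
    have sum: "(\<Sum>k\<in>S. Poly_Mapping.lookup ?v k) = (\<Sum>k\<in>S. Poly_Mapping.lookup v k) - 1"
      using i fin by (simp add: lk sum_subtractf)
    have "\<exists>ks. set ks \<subseteq> S \<and> sum_list (map (\<lambda>k. Poly_Mapping.single k 1) ks) = ?v \<and>
      int (length ks) = (\<Sum>k\<in>S. Poly_Mapping.lookup ?v k)"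
    proof (rule Suc.hyps(1))
      show "n = nat (\<Sum>k\<in>S. Poly_Mapping.lookup ?v k)" using Suc.hyps(2) by (simp add: sum)
      show "Poly_Mapping.lookup ?v k \<ge> 0" for k using Suc.prems(1)[of k] i by (simp add: lk)
      show "Poly_Mapping.keys ?v \<subseteq> S"
        using Suc.prems(2) i by (force simp: in_keys_iff lk split: if_splits)
    qed
    then obtain ks where "set ks \<subseteq> S" "sum_list (map (\<lambda>k. Poly_Mapping.single k 1) ks) = ?v"
      "int (length ks) = (\<Sum>k\<in>S. Poly_Mapping.lookup ?v k)" by blast
    then show ?case
      using i by (intro exI[of _ "i # ks"]) (simp add: sum)
  qed
  then show thesis using that by blast
qed

lemma foldr_dir_shift_units:
  assumes "set ks \<subseteq> {1..m}"
  shows "foldr (dir_shift m) (map (\<lambda>k i. of_bool (i = k)) ks) c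
    = (\<lambda>w. c (w - sum_list (map (\<lambda>k. Poly_Mapping.single k 1) ks)))"
  using assms
proof (induction ks)
  case (Cons k ks)
  then have "k \<in> {1..m}" by simp
  then show ?case
    unfolding list.map foldr_Cons o_apply using Cons
    by (simp add: dir_shift_unit fun_eq_iff diff_diff_eq)
qed simp

text \<open>Arcs out of the root 0 raise the weight at each vertex to at least \<open>w\<close> without changing
  the partition function; \<open>w\<close> is then reached by derivatives in coordinate directions.\<close>

lemma hyperbolic_kostant:
  fixes G :: "(nat, 'e) pre_digraph"
  assumes G: "increasing_multidigraph m G" and keys: "Poly_Mapping.keys w \<subseteq> {1..m}"
    and sum: "(\<Sum>k\<in>{1..m}. Poly_Mapping.lookup w k) = 2"
  shows "hyperbolic (\<lambda>x y. dir_shift m x (dir_shift m y (\<lambda>v. real (kostant G v))) w)"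
proof -
  define src :: "'e + nat \<times> nat \<Rightarrow> nat" where "src = case_sum (tail G) (\<lambda>_. 0)"
  define tgt :: "'e + nat \<times> nat \<Rightarrow> nat" where "tgt = case_sum (head G) fst"
  \<comment> \<open>Weight is in-degree minus one, so \<open>w + 1\<close> parallel root arcs
    suffice; where this number is negative, none are added and the weight is at least -1
    anyway.\<close>
  define b where "b k = nat (Poly_Mapping.lookup w k + 1)" for k
  define R where "R = Sigma {1..m} (\<lambda>k. {..<b k})"
  define A :: "('e + nat \<times> nat) set" where "A = Inl ` arcs G \<union> Inr ` R"
  interpret rooted_arcs m src tgt .
  have [simp]: "src (Inl e) = tail G e" "src (Inr p) = 0" "tgt (Inl e) = head G e" "tgt (Inr p) = fst p" for e p
    by (simp_all add: src_def tgt_def)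
  note GD = increasing_multidigraphD[OF G]
  have A: "admissible A"
    unfolding admissible_def using GD by (auto simp: A_def R_def)
  have coeff: "coeff A = (\<lambda>v. real (kostant G v))"
  proof
    fix v
    have "tail G e \<noteq> 0" if "e \<in> arcs G" for e
      using GD(2)[OF that] by simp
    then have "arcs (inner_graph A) = Inl ` arcs G"
      by (auto simp: A_def)
    then have "kostant (inner_graph A) v = kostant G v"
      by (intro kostant_reindex[where \<phi> = Inl]) simp_all
    then show "coeff A v = real (kostant G v)" by (simp add: coeff_def)
  qed
  define \<gamma> where "\<gamma> = weight A - w"
  have \<gamma>_nonneg: "Poly_Mapping.lookup \<gamma> k \<ge> 0" for k
  proof (cases "k \<in> {1..m}")
    case True
    have "(\<lambda>l. Inr (k, l)) ` {..<b k} \<subseteq> {e\<in>A. tgt e = k}"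
      using True by (auto simp: A_def R_def)
    then have "card ((\<lambda>l. Inr (k, l) :: 'e + nat \<times> nat) ` {..<b k}) \<le> card {e\<in>A. tgt e = k}"
      using A by (intro card_mono) (auto simp: admissible_def)
    then have "b k \<le> card {e\<in>A. tgt e = k}"
      by (simp add: card_image inj_on_def)
    then show ?thesis
      using lookup_weight[OF A True] by (simp add: \<gamma>_def lookup_minus b_def)
  next
    case False
    then have "Poly_Mapping.lookup w k = 0" "Poly_Mapping.lookup (weight A) k = 0"
      using keys keys_weight[OF A] by (meson in_keys_iff subsetD)+
    then show ?thesis by (simp add: \<gamma>_def lookup_minus)
  qed
  have \<gamma>_keys: "Poly_Mapping.keys \<gamma> \<subseteq> {1..m}"
    using keys keys_weight[OF A] keys_diff[of "weight A" w] by (auto simp: \<gamma>_def)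
  obtain ks where ks: "set ks \<subseteq> {1..m}" "sum_list (map (\<lambda>k. Poly_Mapping.single k 1) ks) = \<gamma>"
    and len: "int (length ks) = (\<Sum>k\<in>{1..m}. Poly_Mapping.lookup \<gamma> k)"
    using nonneg_vector_as_list[OF \<gamma>_nonneg \<gamma>_keys] by auto
  let ?us = "map (\<lambda>k i. of_bool (i = k)) ks :: (nat \<Rightarrow> real) list"
  have "hyperbolic (\<lambda>x y. mixed A (x # y # ?us))"
  proof (rule hyperbolic_mixed_nonneg[OF A])
    \<comment> \<open>The coordinate sum 2 of w leaves exactly the two slots x and y open.\<close>
    have "int (length ks) = int (card A) - int m - 2"
      unfolding len \<gamma>_def lookup_minus sum_subtractf sum_weight[OF A] sum ..
    then show "length ?us + 2 + m = card A" by simp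
  qed auto
  moreover have "mixed A (x # y # ?us) = dir_shift m x (dir_shift m y (\<lambda>v. real (kostant G v))) w" for x y
  proof -
    have "mixed A (x # y # ?us) = foldr (dir_shift m) [x, y] (foldr (dir_shift m) ?us (coeff A)) (weight A)"
      by (simp add: mixed_def)
    also have "\<dots> = foldr (dir_shift m) [x, y] (coeff A) (weight A - \<gamma>)"
      unfolding foldr_dir_shift_units[OF ks(1)] ks(2) foldr_dir_shift_translate ..
    also have "weight A - \<gamma> = w" by (simp add: \<gamma>_def)
    finally show ?thesis by (simp add: coeff)
  qed
  ultimately show ?thesis by simp
qed

lemma kostant_nonzeroD:
  assumes G: "increasing_multidigraph m G" and "kostant G v \<noteq> 0"
  shows "Poly_Mapping.keys v \<subseteq> {1..m}" "(\<Sum>k\<in>{1..m}. Poly_Mapping.lookup v k) = 0"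
proof -
  obtain f where f: "net_flow G f = v"
    using assms(2) kostant_eq_0_iff[OF G, of v] by metis
  then show "Poly_Mapping.keys v \<subseteq> {1..m}" "(\<Sum>k\<in>{1..m}. Poly_Mapping.lookup v k) = 0"
    using keys_net_flow[OF G, of f] sum_net_flow[OF G, of f] unfolding f by blast+
qed

text \<open>Evaluate the form at \<open>v + \<epsilon>\<^sub>i + \<epsilon>\<^sub>j\<close> on the
  two unit vectors: its diagonal values are the two outer terms and the mixed value is
  \<open>kostant G v\<close>. The required coordinate sum 2 follows once an outer term is nonzero;
  otherwise the claim is trivial.\<close>

lemma kostant_log_concave:
  assumes G: "increasing_multidigraph m G" and v: "Poly_Mapping.keys v \<subseteq> {1..m}"
    and i: "i \<in> {1..m}" and j: "j \<in> {1..m}"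
  shows "kostant G (v + Poly_Mapping.single i 1 - Poly_Mapping.single j 1) *
    kostant G (v + Poly_Mapping.single j 1 - Poly_Mapping.single i 1) \<le> (kostant G v)\<^sup>2"
    (is "kostant G ?p * kostant G ?q \<le> _")
proof (cases "i = j \<or> kostant G ?p = 0 \<or> kostant G ?q = 0")
  case True
  then show ?thesis by (auto simp: power2_eq_square)
next
  case False
  let ?w = "v + Poly_Mapping.single i 1 + Poly_Mapping.single j 1"
  let ?B = "\<lambda>x y. dir_shift m x (dir_shift m y (\<lambda>v. real (kostant G v))) ?w"
  let ?u = "\<lambda>k i. of_bool (i = k) :: real"
  have single_sum: "(\<Sum>k\<in>{1..m}. Poly_Mapping.lookup (Poly_Mapping.single l 1) k) = (1 :: int)"
    if "l \<in> {1..m}" for l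
    using that by (simp add: lookup_single when_def)
  have "(\<Sum>k\<in>{1..m}. Poly_Mapping.lookup ?p k) = 0"
    by (rule kostant_nonzeroD(2)[OF G]) (use False in simp)
  then have "(\<Sum>k\<in>{1..m}. Poly_Mapping.lookup v k) = 0"
    using i j
    by (simp only: lookup_add lookup_minus sum.distrib sum_subtractf single_sum add_diff_cancel_right')
  then have "(\<Sum>k\<in>{1..m}. Poly_Mapping.lookup ?w k) = 2"
    using i j by (simp only: lookup_add sum.distrib single_sum)
  moreover have "Poly_Mapping.keys ?w \<subseteq> {1..m}"
  proof -
    have add: "Poly_Mapping.keys (a + b) \<subseteq> {1..m}"
      if "Poly_Mapping.keys a \<subseteq> {1..m}" "Poly_Mapping.keys b \<subseteq> {1..m}" for a b :: "nat \<Rightarrow>\<^sub>0 int"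
      using Poly_Mapping.keys_add[of a b] that by blast
    show ?thesis by (intro add v) (use i j in simp_all)
  qed
  ultimately have hyp: "hyperbolic ?B" by (intro hyperbolic_kostant[OF G])
  have B: "?B (?u i) (?u i) = real (kostant G ?q)" "?B (?u j) (?u j) = real (kostant G ?p)"
    "?B (?u i) (?u j) = real (kostant G v)"
  proof -
    have "a + b + c - b - b = a + c - b" "a + b + c - c - c = a + b - c" "a + b + c - b - c = a"
      for a b c :: "nat \<Rightarrow>\<^sub>0 int"
      by (simp_all add: poly_mapping_eqI lookup_add lookup_minus)
    then show "?B (?u i) (?u i) = real (kostant G ?q)" "?B (?u j) (?u j) = real (kostant G ?p)"
      "?B (?u i) (?u j) = real (kostant G v)"
      by (simp_all only: dir_shift_unit[OF i] dir_shift_unit[OF j])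
  qed
  have "real (kostant G ?p) > 0" using False by simp
  then have "real (kostant G ?q) * real (kostant G ?p) \<le> (real (kostant G v))\<^sup>2"
    unfolding B[symmetric] by (rule hyp[unfolded hyperbolic_def, rule_format])
  then have "real (kostant G ?p * kostant G ?q) \<le> real ((kostant G v)\<^sup>2)"
    by (simp add: mult.commute)
  then show ?thesis by (rule of_nat_le_iff[THEN iffD1])
qed

section \<open>Normalized coefficients, derivatives and quadratic forms\<close>

definition fact_exponent :: "(nat \<Rightarrow>\<^sub>0 nat) \<Rightarrow> real" where
  "fact_exponent \<mu> = (\<Prod>j\<in>Poly_Mapping.keys \<mu>. fact (Poly_Mapping.lookup \<mu> j))"

lemma fact_exponent_superset:
  assumes "finite S" "Poly_Mapping.keys \<mu> \<subseteq> S"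
  shows "fact_exponent \<mu> = (\<Prod>j\<in>S. fact (Poly_Mapping.lookup \<mu> j))"
  unfolding fact_exponent_def
  by (rule prod.mono_neutral_left) (use assms in \<open>auto simp: in_keys_iff\<close>)

lemma fact_exponent_add_single:
  "fact_exponent (\<mu> + Poly_Mapping.single i 1) = real (Poly_Mapping.lookup \<mu> i + 1) * fact_exponent \<mu>"
proof -
  let ?S = "insert i (Poly_Mapping.keys \<mu>)"
  have "Poly_Mapping.keys (\<mu> + Poly_Mapping.single i 1) \<subseteq> ?S"
    using Poly_Mapping.keys_add[of \<mu> "Poly_Mapping.single i 1"] by auto
  then have "fact_exponent (\<mu> + Poly_Mapping.single i 1)
      = (\<Prod>j\<in>?S. fact (Poly_Mapping.lookup (\<mu> + Poly_Mapping.single i 1) j))"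
    by (intro fact_exponent_superset) auto
  also have "\<dots> = fact (Poly_Mapping.lookup \<mu> i + 1) * (\<Prod>j\<in>?S - {i}. fact (Poly_Mapping.lookup \<mu> j))"
    by (subst prod.remove[of _ i]) (auto simp: lookup_add lookup_single intro!: prod.cong)
  also have "\<dots> = real (Poly_Mapping.lookup \<mu> i + 1) *
      (fact (Poly_Mapping.lookup \<mu> i) * (\<Prod>j\<in>?S - {i}. fact (Poly_Mapping.lookup \<mu> j)))"
    by simp
  also have "fact (Poly_Mapping.lookup \<mu> i) * (\<Prod>j\<in>?S - {i}. fact (Poly_Mapping.lookup \<mu> j)) = fact_exponent \<mu>"
  proof -
    have "fact_exponent \<mu> = (\<Prod>j\<in>?S. fact (Poly_Mapping.lookup \<mu> j))"
      by (rule fact_exponent_superset) auto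
    also have "\<dots> = fact (Poly_Mapping.lookup \<mu> i) * (\<Prod>j\<in>?S - {i}. fact (Poly_Mapping.lookup \<mu> j))"
      by (rule prod.remove) auto
    finally show ?thesis by (rule sym)
  qed
  finally show ?thesis .
qed

lemma fact_exponent_pos: "fact_exponent \<mu> > 0"
  unfolding fact_exponent_def by (intro prod_pos) simp

lemma lookup_partial_deriv:
  "Poly_Mapping.lookup (partial_deriv i h) \<beta>
    = real (Poly_Mapping.lookup \<beta> i + 1) * Poly_Mapping.lookup h (\<beta> + Poly_Mapping.single i 1)"
proof -
  let ?s = "Poly_Mapping.single i (1 :: nat)"
  \<comment> \<open>Truncated subtraction spoils this equivalence only for exponents with i-th entry
    0, whose terms carry the factor 0.\<close>
  have eq: "\<alpha> - ?s = \<beta> \<longleftrightarrow> \<alpha> = \<beta> + ?s" if "Poly_Mapping.lookup \<alpha> i > 0" for \<alpha>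
  proof
    assume "\<alpha> - ?s = \<beta>"
    moreover have "\<alpha> - ?s + ?s = \<alpha>"
      using that by (intro poly_mapping_eqI) (auto simp: lookup_add lookup_minus lookup_single when_def)
    ultimately show "\<alpha> = \<beta> + ?s" by simp
  qed simp
  have "Poly_Mapping.lookup (partial_deriv i h) \<beta> = (\<Sum>\<alpha>\<in>Poly_Mapping.keys h.
      if \<alpha> = \<beta> + ?s then real (Poly_Mapping.lookup \<alpha> i) * Poly_Mapping.lookup h \<alpha> else 0)"
    unfolding partial_deriv_def lookup_sum
  proof (intro sum.cong refl)
    fix \<alpha>
    show "Poly_Mapping.lookup (Poly_Mapping.single (\<alpha> - ?s) (real (Poly_Mapping.lookup \<alpha> i) * Poly_Mapping.lookup h \<alpha>)) \<beta>
      = (if \<alpha> = \<beta> + ?s then real (Poly_Mapping.lookup \<alpha> i) * Poly_Mapping.lookup h \<alpha> else 0)"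
    proof (cases "Poly_Mapping.lookup \<alpha> i > 0")
      case True
      then show ?thesis by (simp only: lookup_single when_def eq)
    next
      case False
      then show ?thesis by auto
    qed
  qed
  also have "\<dots> = (if \<beta> + ?s \<in> Poly_Mapping.keys h
      then real (Poly_Mapping.lookup (\<beta> + ?s) i) * Poly_Mapping.lookup h (\<beta> + ?s) else 0)"
    by (subst sum.delta) auto
  also have "\<dots> = real (Poly_Mapping.lookup \<beta> i + 1) * Poly_Mapping.lookup h (\<beta> + ?s)"
    by (simp add: in_keys_iff lookup_add)
  finally show ?thesis .
qed

lemma lookup_int_exponent: "Poly_Mapping.lookup (int_exponent \<mu>) k = int (Poly_Mapping.lookup \<mu> k)"
  by (simp add: map.rep_eq when_def)

lemma int_exponent_add: "int_exponent (\<mu> + \<nu>) = int_exponent \<mu> + int_exponent \<nu>"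
  by (intro poly_mapping_eqI) (simp add: lookup_int_exponent lookup_add)

lemma int_exponent_single: "int_exponent (Poly_Mapping.single i n) = Poly_Mapping.single i (int n)"
  by (intro poly_mapping_eqI) (simp add: lookup_int_exponent lookup_single when_def)

lemma keys_int_exponent: "Poly_Mapping.keys (int_exponent \<mu>) = Poly_Mapping.keys \<mu>"
  by (auto simp: in_keys_iff lookup_int_exponent)

lemma normalize_series_alt: "normalize_series c \<mu> = c (int_exponent \<mu>) / fact_exponent \<mu>"
  by (simp add: normalize_series_def fact_exponent_def)

text \<open>The factor produced by differentiation cancels against the factorial in the
  normalization, so derivatives become plain shifts of c.\<close>

lemma lookup_partial_derivs:
  assumes "Poly_Mapping.lookup h = normalize_series c"
  shows "Poly_Mapping.lookup (foldr partial_deriv is h)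
    = normalize_series (\<lambda>\<mu>. c (\<mu> + sum_list (map (\<lambda>i. Poly_Mapping.single i 1) is)))"
proof (induction "is")
  case Nil
  then show ?case using assms by simp
next
  case (Cons i "is")
  show ?case
  proof
    fix \<beta>
    have "real (Poly_Mapping.lookup \<beta> i + 1) \<noteq> 0" by linarith
    then show "Poly_Mapping.lookup (foldr partial_deriv (i # is) h) \<beta>
      = normalize_series (\<lambda>\<mu>. c (\<mu> + sum_list (map (\<lambda>i. Poly_Mapping.single i 1) (i # is)))) \<beta>"
      unfolding foldr_Cons o_apply lookup_partial_deriv Cons.IH normalize_series_alt
        fact_exponent_add_single int_exponent_add int_exponent_single
      by (simp add: add.assoc)
  qed
qed

text \<open>The factorial 2! on the diagonal and the halving off the diagonal give the same factor,
  so one formula covers both.\<close>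

lemma quadratic_form_mat_normalize:
  assumes "Poly_Mapping.lookup q = normalize_series c"
  shows "quadratic_form_mat m q = mat m m (\<lambda>(r, s).
    c (Poly_Mapping.single (Suc r) 1 + Poly_Mapping.single (Suc s) 1) / 2)"
proof -
  have "fact_exponent 0 = 1" by (simp add: fact_exponent_def)
  then have single: "fact_exponent (Poly_Mapping.single k 1) = 1" for k
    using fact_exponent_add_single[of 0 k] by simp
  have "fact_exponent (Poly_Mapping.single k 1 + Poly_Mapping.single l 1) = (if k = l then 2 else 1)" for k l
    unfolding fact_exponent_add_single single by (simp add: lookup_single when_def)
  moreover have "Poly_Mapping.single k (2 :: nat) = Poly_Mapping.single k 1 + Poly_Mapping.single k 1" for k :: nat
    by (simp only: single_add[symmetric] one_add_one)
  ultimately show ?thesis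
    unfolding quadratic_form_mat_def assms normalize_series_alt
    by (intro cong_mat refl) (auto simp: int_exponent_add int_exponent_single)
qed

text \<open>Links the 0-based matrix indices to the variables \<open>1, \<dots>, m\<close>; hence
  the entries \<open>k - 1\<close> and the successors.\<close>

lemma bilinear_mat_shift:
  fixes c :: "(nat \<Rightarrow>\<^sub>0 int) \<Rightarrow> real"
  assumes x: "x \<in> carrier_vec m" and y: "y \<in> carrier_vec m"
  shows "x \<bullet> (mat m m (\<lambda>(r, s). c (w - Poly_Mapping.single (Suc r) 1 - Poly_Mapping.single (Suc s) 1) / 2) *\<^sub>v y)
    = dir_shift m (\<lambda>k. x $ (k - 1)) (dir_shift m (\<lambda>k. y $ (k - 1)) c) w / 2"
proof -
  have "dir_shift m (\<lambda>k. x $ (k - 1)) (dir_shift m (\<lambda>k. y $ (k - 1)) c) w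
    = (\<Sum>r<m. \<Sum>s<m. x $ r * (y $ s * c (w - Poly_Mapping.single (Suc r) 1 - Poly_Mapping.single (Suc s) 1)))"
    by (simp only: dir_shift_def One_nat_def sum.atLeast1_atMost_eq diff_Suc_Suc diff_zero sum_distrib_left)
  moreover have "x \<bullet> (mat m m (\<lambda>(r, s). c (w - Poly_Mapping.single (Suc r) 1 - Poly_Mapping.single (Suc s) 1) / 2) *\<^sub>v y)
    = (\<Sum>r<m. \<Sum>s<m. x $ r * (y $ s * c (w - Poly_Mapping.single (Suc r) 1 - Poly_Mapping.single (Suc s) 1))) / 2"
    unfolding scalar_prod_def sum_divide_distrib atLeast0LessThan[symmetric]
    using x y by (auto simp: scalar_prod_def sum_distrib_left mult_ac intro!: sum.cong)
  ultimately show ?thesis by simp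
qed

lemma finite_exponents: "finite {\<mu> :: nat \<Rightarrow>\<^sub>0 nat. Poly_Mapping.keys \<mu> \<subseteq> {1..m} \<and> (\<Sum>k\<in>{1..m}. Poly_Mapping.lookup \<mu> k) = d}"
  (is "finite ?S")
proof (rule finite_imageD)
  let ?f = "\<lambda>\<mu> :: nat \<Rightarrow>\<^sub>0 nat. restrict (Poly_Mapping.lookup \<mu>) {1..m}"
  have "?f ` ?S \<subseteq> {1..m} \<rightarrow>\<^sub>E {..d}"
  proof
    fix g assume "g \<in> ?f ` ?S"
    then obtain \<mu> where g: "g = ?f \<mu>" and \<mu>: "(\<Sum>k\<in>{1..m}. Poly_Mapping.lookup \<mu> k) = d" by blast
    have "Poly_Mapping.lookup \<mu> k \<le> d" if "k \<in> {1..m}" for k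
      unfolding \<mu>[symmetric] using that by (intro member_le_sum) auto
    then show "g \<in> {1..m} \<rightarrow>\<^sub>E {..d}" by (simp add: g)
  qed
  then show "finite (?f ` ?S)" by (rule finite_subset) (simp add: finite_PiE)
  show "inj_on ?f ?S"
  proof (rule inj_onI)
    fix \<mu> \<nu> assume S: "\<mu> \<in> ?S" "\<nu> \<in> ?S" and eq: "?f \<mu> = ?f \<nu>"
    show "\<mu> = \<nu>"
    proof (rule poly_mapping_eqI)
      fix k
      show "Poly_Mapping.lookup \<mu> k = Poly_Mapping.lookup \<nu> k"
      proof (cases "k \<in> {1..m}")
        case True
        then show ?thesis using fun_cong[OF eq, of k] by simp
      next
        case False
        then have "k \<notin> Poly_Mapping.keys \<mu>" "k \<notin> Poly_Mapping.keys \<nu>" using S by auto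
        then show ?thesis by (simp add: in_keys_iff)
      qed
    qed
  qed
qed

lemma lorentzian_kostant:
  assumes G: "increasing_multidigraph m G" and \<delta>: "Poly_Mapping.keys \<delta> \<subseteq> {1..m}"
  shows "\<exists>h. Poly_Mapping.lookup h = normalize_series (monom_times \<delta> (kostant_gf G)) \<and> lorentzian m h"
proof -
  define K where "K v = real (kostant G v)" for v
  define d where "d = (\<Sum>k\<in>{1..m}. Poly_Mapping.lookup \<delta> k)"
  let ?c = "monom_times \<delta> (kostant_gf G)"
  have c: "?c v = K (int_exponent \<delta> - v)" for v
    by (simp add: monom_times_def kostant_gf_def K_def)
  have c_nz: "Poly_Mapping.keys \<mu> \<subseteq> {1..m} \<and> (\<Sum>k\<in>{1..m}. Poly_Mapping.lookup \<mu> k) = d"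
    if "kostant G (int_exponent \<delta> - int_exponent \<mu>) \<noteq> 0" for \<mu>
  proof
    note nz = kostant_nonzeroD[OF G that]
    show "Poly_Mapping.keys \<mu> \<subseteq> {1..m}"
    proof
      fix k assume k: "k \<in> Poly_Mapping.keys \<mu>"
      show "k \<in> {1..m}"
      proof (rule ccontr)
        assume "k \<notin> {1..m}"
        then have "Poly_Mapping.lookup \<delta> k = 0"
          "Poly_Mapping.lookup (int_exponent \<delta> - int_exponent \<mu>) k = 0"
          using \<delta> nz(1) by (meson in_keys_iff subsetD)+
        then show False using k by (simp add: lookup_minus lookup_int_exponent in_keys_iff)
      qed
    qed
    have "int d - int (\<Sum>k\<in>{1..m}. Poly_Mapping.lookup \<mu> k) = 0"
      using nz(2) by (simp add: lookup_minus lookup_int_exponent sum_subtractf d_def)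
    then show "(\<Sum>k\<in>{1..m}. Poly_Mapping.lookup \<mu> k) = d" by linarith
  qed
  \<comment> \<open>Nonzero coefficients have exponents of total degree d, the degree of
    \<open>\<delta>\<close>, because net flows sum to zero; so the series is a polynomial.\<close>
  have "finite {\<mu>. normalize_series ?c \<mu> \<noteq> 0}"
    by (rule finite_subset[OF _ finite_exponents[of m d]])
      (use c_nz in \<open>auto simp: normalize_series_alt c K_def\<close>)
  then have "Poly_Mapping.lookup (Abs_poly_mapping (normalize_series ?c)) = normalize_series ?c"
    by (intro Abs_poly_mapping_inverse) simp
  then obtain h where h: "Poly_Mapping.lookup h = normalize_series ?c" by (rule that)
  have lookup_h: "Poly_Mapping.lookup h \<mu> = K (int_exponent \<delta> - int_exponent \<mu>) / fact_exponent \<mu>" for \<mu>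
    by (simp add: h normalize_series_alt c)
  have keys_h: "\<mu> \<in> Poly_Mapping.keys h \<longleftrightarrow> kostant G (int_exponent \<delta> - int_exponent \<mu>) \<noteq> 0" for \<mu>
    using fact_exponent_pos[of \<mu>] by (simp add: in_keys_iff lookup_h K_def)
  have keys_h_flow: "\<mu> \<in> Poly_Mapping.keys h \<longleftrightarrow> (\<exists>f. net_flow G f = int_exponent \<delta> - int_exponent \<mu>)" for \<mu>
    unfolding keys_h using kostant_eq_0_iff[OF G] by metis
  have hom: "homogeneous_poly m d h"
    unfolding homogeneous_poly_def using c_nz keys_h by blast
  moreover have "Poly_Mapping.lookup h \<alpha> \<ge> 0" for \<alpha>
    using fact_exponent_pos[of \<alpha>] by (simp add: lookup_h K_def)
  moreover have "M_convex m (Poly_Mapping.keys h)"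
    unfolding M_convex_def
  proof (intro ballI impI)
    fix \<alpha> \<beta> i
    assume \<alpha>: "\<alpha> \<in> Poly_Mapping.keys h" and \<beta>: "\<beta> \<in> Poly_Mapping.keys h"
      and i: "Poly_Mapping.lookup \<beta> i < Poly_Mapping.lookup \<alpha> i"
    obtain f where f: "net_flow G f = int_exponent \<delta> - int_exponent \<alpha>" using \<alpha> keys_h_flow by blast
    obtain g where g: "net_flow G g = int_exponent \<delta> - int_exponent \<beta>" using \<beta> keys_h_flow by blast
    \<comment> \<open>Exponents enter the flow vector with a minus sign, so a surplus of
      \<open>\<alpha>\<close> at i is a deficit of f there.\<close>
    have "Poly_Mapping.lookup (net_flow G f) i < Poly_Mapping.lookup (net_flow G g) i"
      using i by (simp add: f g lookup_minus lookup_int_exponent)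
    then obtain j f' where j: "Poly_Mapping.lookup (net_flow G g) j < Poly_Mapping.lookup (net_flow G f) j"
      and f': "net_flow G f' = net_flow G f + Poly_Mapping.single i 1 - Poly_Mapping.single j 1"
      using net_flow_exchange[of G f i g] increasing_multidigraphD[OF G] by (metis less_irrefl)
    have ij: "Poly_Mapping.lookup \<alpha> j < Poly_Mapping.lookup \<beta> j"
      using j by (simp add: f g lookup_minus lookup_int_exponent)
    then have "j \<in> Poly_Mapping.keys \<beta>" by (simp add: in_keys_iff)
    then have "j \<in> {1..m}" using c_nz \<beta> keys_h by blast
    \<comment> \<open>The truncated subtraction is exact, since \<open>\<alpha>\<close> exceeds
      \<open>\<beta>\<close> at i and is therefore positive there.\<close>
    have "int_exponent (\<alpha> - Poly_Mapping.single i 1 + Poly_Mapping.single j 1)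
        = int_exponent \<alpha> - Poly_Mapping.single i 1 + Poly_Mapping.single j 1"
      using i by (intro poly_mapping_eqI)
        (auto simp: lookup_int_exponent lookup_add lookup_minus lookup_single when_def of_nat_diff)
    then have "net_flow G f' = int_exponent \<delta> - int_exponent (\<alpha> - Poly_Mapping.single i 1 + Poly_Mapping.single j 1)"
      by (simp add: f' f)
    then have "\<alpha> - Poly_Mapping.single i 1 + Poly_Mapping.single j 1 \<in> Poly_Mapping.keys h"
      using keys_h_flow by blast
    then show "\<exists>j\<in>{1..m}. Poly_Mapping.lookup \<alpha> j < Poly_Mapping.lookup \<beta> j \<and>
        \<alpha> - Poly_Mapping.single i 1 + Poly_Mapping.single j 1 \<in> Poly_Mapping.keys h"
      using ij \<open>j \<in> {1..m}\<close> by blast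
  qed
  moreover have "num_pos_eigenvalues (quadratic_form_mat m (foldr partial_deriv is h)) \<le> 1"
    if d2: "d \<ge> 2" and len: "length is = d - 2" and "set is \<subseteq> {1..m}" for "is"
  proof -
    define \<sigma> :: "nat \<Rightarrow>\<^sub>0 int" where "\<sigma> = sum_list (map (\<lambda>i. Poly_Mapping.single i 1) is)"
    \<comment> \<open>After \<open>d - 2\<close> derivatives the remaining vector has coordinate sum
      2, as the hyperbolicity of the partition function requires.\<close>
    define w where "w = int_exponent \<delta> - \<sigma>"
    have \<sigma>: "Poly_Mapping.keys \<sigma> \<subseteq> {1..m}" "(\<Sum>k\<in>{1..m}. Poly_Mapping.lookup \<sigma> k) = int (length is)"
      unfolding \<sigma>_def using that(3)
    proof (induction "is")
      case (Cons i "is")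
      {
        case 1
        then show ?case
          using Cons.IH(1) Poly_Mapping.keys_add[of "Poly_Mapping.single i (1 :: int)"
              "sum_list (map (\<lambda>i. Poly_Mapping.single i 1) is)"] by force
      next
        case 2
        then show ?case
          using Cons.IH(2) by (simp add: lookup_add sum.distrib lookup_single when_def)
      }
    qed simp_all
    have "Poly_Mapping.keys w \<subseteq> {1..m}"
      unfolding w_def using keys_diff[of "int_exponent \<delta>" \<sigma>] \<sigma>(1) \<delta> keys_int_exponent[of \<delta>] by blast
    moreover have "(\<Sum>k\<in>{1..m}. Poly_Mapping.lookup w k) = 2"
    proof -
      have "(\<Sum>k\<in>{1..m}. Poly_Mapping.lookup w k) = int d - int (length is)"
        by (simp only: w_def lookup_minus sum_subtractf \<sigma>(2) lookup_int_exponent d_def of_nat_sum)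
      then show ?thesis using len d2 by simp
    qed
    ultimately have hyp: "hyperbolic (\<lambda>x y. dir_shift m x (dir_shift m y K) w)"
      unfolding K_def[abs_def] by (rule hyperbolic_kostant[OF G])
    define Q where "Q = mat m m (\<lambda>(r, s). K (w - Poly_Mapping.single (Suc r) 1 - Poly_Mapping.single (Suc s) 1) / 2)"
    have "quadratic_form_mat m (foldr partial_deriv is h) = Q"
      unfolding quadratic_form_mat_normalize[OF lookup_partial_derivs[OF h]] Q_def c \<sigma>_def[symmetric]
      by (simp add: w_def algebra_simps)
    moreover have "num_pos_eigenvalues Q \<le> 1"
    proof (rule num_pos_eigenvalues_le_1)
      show "Q \<in> carrier_mat m m" by (simp add: Q_def)
      show "Q\<^sup>T = Q"
        unfolding Q_def by (rule eq_matI) (auto intro!: arg_cong[of _ _ K] cancel_ab_semigroup_add_class.diff_right_commute)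
      fix x y :: "real vec"
      assume xy: "x \<in> carrier_vec m" "y \<in> carrier_vec m" and pos: "0 < y \<bullet> (Q *\<^sub>v y)"
      let ?x = "\<lambda>k. x $ (k - 1)" and ?y = "\<lambda>k. y $ (k - 1)"
      let ?B = "\<lambda>x y. dir_shift m x (dir_shift m y K) w"
      have "?B ?x ?x * ?B ?y ?y \<le> (?B ?x ?y)\<^sup>2"
        using hyp pos unfolding Q_def bilinear_mat_shift[OF xy(2) xy(2)] hyperbolic_def by simp
      then show "x \<bullet> (Q *\<^sub>v x) * (y \<bullet> (Q *\<^sub>v y)) \<le> (x \<bullet> (Q *\<^sub>v y))\<^sup>2"
        unfolding Q_def bilinear_mat_shift[OF xy(1) xy(1)] bilinear_mat_shift[OF xy(2) xy(2)]
          bilinear_mat_shift[OF xy] by (simp add: power_divide)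
    qed
    ultimately show ?thesis by simp
  qed
  ultimately have "lorentzian m h"
    unfolding lorentzian_def by blast
  then show ?thesis using h by blast
qed

theorem theorem1p6:
  fixes n :: nat and G :: "(nat, 'e) pre_digraph"
  assumes "increasing_multidigraph (n + 1) G"
  shows
    "(\<forall>v. Poly_Mapping.keys v \<subseteq> {1..n + 1} \<longrightarrow>
        (\<forall>i\<in>{1..n + 1}. \<forall>j\<in>{1..n + 1}.
          (kostant G v)\<^sup>2 \<ge>
            kostant G (v + Poly_Mapping.single i 1 - Poly_Mapping.single j 1) *
            kostant G (v + Poly_Mapping.single j 1 - Poly_Mapping.single i 1))) \<and>
     (\<forall>\<delta>. Poly_Mapping.keys \<delta> \<subseteq> {1..n + 1} \<longrightarrow>
        (\<exists>h. Poly_Mapping.lookup h = normalize_series (monom_times \<delta> (kostant_gf G)) \<and>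
             lorentzian (n + 1) h))"
  using kostant_log_concave[OF assms] lorentzian_kostant[OF assms] by blast

end
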